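(* Let $B$ be a finite two-sided skew brace. If one of the following conditions holds: (1) $B$ is quasi-simple (as a skew brace); (2) the additive group $(B,+)$ is quasi-simple; (3) the multiplicative group $(B,\cdot)$ is quasi-simple, then $B$ is either trivial or almost trivial.
   Context: A skew brace is a triple $(B,+,\cdot)$ such that $(B,+)$ and $(B,\cdot)$ are groups (neither assumed abelian) and $a\cdot(b+c)=a\cdot b-a+a\cdot c$ for all $a,b,c\in B$; both groups have the same identity, denoted $0$. It is two-sided if moreover $(a+b)c=ac-c+bc$ for all $a,b,c\in B$. For $b\in B$ put $\lambda_b(a)=-b+ba$. A subset $I\subseteq B$ is an ideal if $(I,+)\trianglelefteq(B,+)$, $(I,\cdot)\trianglelefteq(B,\cdot)$ and $\lambda_b(I)\subseteq I$ for all $b\in B$; then $a+I=aI$ for all $a\in B$ and $B/I$ is a skew brace. The center $Z(B)$ is the set of $z\in B$ that are central in both $(B,+)$ and $(B,\cdot)$ and satisfy $\lambda_z=\operatorname{id}_B$; it is an ideal. A skew brace is simple if it is non-zero and its only ideals are $0$ and itself. The commutator ideal $[B,B]^B$ is the ideal of $B$ generated by the additive commutators, the multiplicative commutators and the elements $ab-(a+b)$, $a,b\in B$. The skew brace $B$ is perfect if $B=[B,B]^B$, and quasi-simple if $B$ is perfect and $B/Z(B)$ is simple. A group $G$ is quasi-simple if it is perfect (equal to its derived subgroup) and $G/Z(G)$ is a simple group. A skew brace $B$ is trivial if $ab=a+b$ for all $a,b\in B$, and almost trivial if $ab=b+a$ for all $a,b\in B$. *)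

theory Defs
  imports "HOL-Algebra.QuotRing" "HOL-Algebra.SimpleGroups" "HOL-Algebra.Generated_Groups"
begin

text \<open>
  Skew braces live on the \<open>ring\<close> records of HOL-Algebra: \<open>add_monoid B\<close> is the additive group and
  \<open>B\<close> itself, read as a monoid record, is the multiplicative group. No ring axiom is assumed; in
  particular \<open>\<oplus>\<close> need not commute. That the two identities agree is a consequence of
  the axioms, see \<open>zero_eq_one\<close> below.
\<close>

locale skew_brace = group B for B (structure) +
  assumes add_group: "group (add_monoid B)"
    and left_distrib: "\<lbrakk>a \<in> carrier B; b \<in> carrier B; c \<in> carrier B\<rbrakk>
      \<Longrightarrow> a \<otimes> (b \<oplus> c) = a \<otimes> b \<ominus> a \<oplus> a \<otimes> c"

lemma (in skew_brace) zero_eq_one: "\<zero> = \<one>"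
proof -
  interpret A: group "add_monoid B"
    by (rule add_group)
  have z: "\<zero> \<in> carrier B"
    using A.one_closed by simp
  have *: "x \<oplus> \<zero> = x" "\<zero> \<oplus> x = x" if "x \<in> carrier B" for x
    using A.r_one[of x] A.l_one[of x] that by simp_all
  have "\<one> \<otimes> (\<zero> \<oplus> \<zero>) = \<one> \<otimes> \<zero> \<ominus> \<one> \<oplus> \<one> \<otimes> \<zero>"
    using left_distrib[OF one_closed z z] .
  moreover have "\<ominus> \<one> \<in> carrier B"
    using A.inv_closed[of \<one>] by (simp add: a_inv_def)
  ultimately have "\<ominus> \<one> = \<zero>"
    using z by (simp add: * a_minus_def)
  then show ?thesis
    using A.r_inv[of \<one>] one_closed by (simp add: a_inv_def *)
qed

locale two_sided_skew_brace = skew_brace +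
  assumes right_distrib: "\<lbrakk>a \<in> carrier B; b \<in> carrier B; c \<in> carrier B\<rbrakk>
      \<Longrightarrow> (a \<oplus> b) \<otimes> c = a \<otimes> c \<ominus> c \<oplus> b \<otimes> c"

definition brace_lambda :: "('a, 'b) ring_scheme \<Rightarrow> 'a \<Rightarrow> 'a \<Rightarrow> 'a" where
  "brace_lambda B b a = \<ominus>\<^bsub>B\<^esub> b \<oplus>\<^bsub>B\<^esub> b \<otimes>\<^bsub>B\<^esub> a"

definition brace_ideal :: "('a, 'b) ring_scheme \<Rightarrow> 'a set \<Rightarrow> bool" where
  "brace_ideal B I \<longleftrightarrow> I \<lhd> add_monoid B \<and> I \<lhd> B \<and>
    (\<forall>b\<in>carrier B. brace_lambda B b ` I \<subseteq> I)"

definition group_center :: "('a, 'b) monoid_scheme \<Rightarrow> 'a set" where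
  "group_center G = {z \<in> carrier G. \<forall>x\<in>carrier G. z \<otimes>\<^bsub>G\<^esub> x = x \<otimes>\<^bsub>G\<^esub> z}"

definition brace_center :: "('a, 'b) ring_scheme \<Rightarrow> 'a set" where
  "brace_center B = {z \<in> group_center (add_monoid B) \<inter> group_center B.
    \<forall>a\<in>carrier B. brace_lambda B z a = a}"

definition brace_ideal_generated :: "('a, 'b) ring_scheme \<Rightarrow> 'a set \<Rightarrow> 'a set" where
  "brace_ideal_generated B S = \<Inter>{I. brace_ideal B I \<and> S \<subseteq> I}"

definition commutator_ideal :: "('a, 'b) ring_scheme \<Rightarrow> 'a set" where
  "commutator_ideal B = brace_ideal_generated B
    (derived_set (add_monoid B) (carrier B) \<union> derived_set B (carrier B) \<union>
     {a \<otimes>\<^bsub>B\<^esub> b \<ominus>\<^bsub>B\<^esub> (a \<oplus>\<^bsub>B\<^esub> b) | a b. a \<in> carrier B \<and> b \<in> carrier B})"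

locale simple_skew_brace = skew_brace +
  assumes nonzero: "carrier B \<noteq> {\<zero>}"
    and ideal_cases: "brace_ideal B I \<Longrightarrow> I = {\<zero>} \<or> I = carrier B"

text \<open>
  The library quotient \<open>B Quot I\<close> consists of the additive cosets of \<open>I\<close>, with the operations
  induced by \<open>\<oplus>\<close> and \<open>\<otimes>\<close>; its definition makes sense for an ideal of a skew brace and
  yields the quotient skew brace, see \<open>skew_brace_Quot\<close> below.
\<close>

definition perfect_skew_brace :: "('a, 'b) ring_scheme \<Rightarrow> bool" where
  "perfect_skew_brace B \<longleftrightarrow> skew_brace B \<and> carrier B = commutator_ideal B"

definition quasi_simple_skew_brace :: "('a, 'b) ring_scheme \<Rightarrow> bool" where
  "quasi_simple_skew_brace B \<longleftrightarrow>
    perfect_skew_brace B \<and> simple_skew_brace (B Quot brace_center B)"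

text \<open>
  The library's \<open>simple_group\<close> requires \<open>1 < card\<close> of the carrier, so it covers finite groups only.
  The notion below is therefore meant for finite groups.
\<close>

definition quasi_simple_group :: "('a, 'b) monoid_scheme \<Rightarrow> bool" where
  "quasi_simple_group G \<longleftrightarrow>
    group G \<and> derived G (carrier G) = carrier G \<and> simple_group (G Mod group_center G)"

definition trivial_skew_brace :: "('a, 'b) ring_scheme \<Rightarrow> bool" where
  "trivial_skew_brace B \<longleftrightarrow> skew_brace B \<and>
    (\<forall>a\<in>carrier B. \<forall>b\<in>carrier B. a \<otimes>\<^bsub>B\<^esub> b = a \<oplus>\<^bsub>B\<^esub> b)"

definition almost_trivial_skew_brace :: "('a, 'b) ring_scheme \<Rightarrow> bool" where
  "almost_trivial_skew_brace B \<longleftrightarrow> skew_brace B \<and>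
    (\<forall>a\<in>carrier B. \<forall>b\<in>carrier B. a \<otimes>\<^bsub>B\<^esub> b = b \<oplus>\<^bsub>B\<^esub> a)"

context skew_brace
begin

interpretation A: group "add_monoid B"
  rewrites "carrier (add_monoid B) = carrier B"
    and "monoid.mult (add_monoid B) = add B"
    and "one (add_monoid B) = zero B"
    and "m_inv (add_monoid B) = a_inv B"
    and "r_coset (add_monoid B) = a_r_coset B"
    and "l_coset (add_monoid B) = a_l_coset B"
    and "set_mult (add_monoid B) = set_add B"
    and "RCOSETS (add_monoid B) = A_RCOSETS B"
  by (rule add_group) (auto simp: a_inv_def a_r_coset_def a_l_coset_def set_add_def A_RCOSETS_def fun_eq_iff)

lemma add_cancel:
  assumes "a \<in> carrier B" "b \<in> carrier B"
  shows "\<ominus> a \<oplus> (a \<oplus> b) = b" "a \<oplus> (\<ominus> a \<oplus> b) = b"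
  using assms by (simp_all add: A.m_assoc[symmetric])

lemma mult_eq_add_lambda:
  "\<lbrakk>a \<in> carrier B; b \<in> carrier B\<rbrakk> \<Longrightarrow> a \<otimes> b = a \<oplus> brace_lambda B a b"
  by (simp add: brace_lambda_def A.m_assoc[symmetric])

lemma lambda_closed:
  "\<lbrakk>a \<in> carrier B; b \<in> carrier B\<rbrakk> \<Longrightarrow> brace_lambda B a b \<in> carrier B"
  by (simp add: brace_lambda_def)

lemma lambda_mult:
  assumes "a \<in> carrier B" "b \<in> carrier B" "c \<in> carrier B"
  shows "brace_lambda B a (brace_lambda B b c) = brace_lambda B (a \<otimes> b) c"
proof -
  have 0: "a \<otimes> \<zero> = a" using assms zero_eq_one by simp
  have 1: "a \<otimes> (\<ominus> b) = a \<ominus> a \<otimes> b \<oplus> a"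
  proof -
    have "a = (a \<otimes> b \<ominus> a) \<oplus> a \<otimes> (\<ominus> b)"
      using left_distrib[of a b "\<ominus> b"] assms 0 by simp
    moreover have "a \<ominus> a \<otimes> b \<oplus> (a \<otimes> b \<ominus> a \<oplus> a \<otimes> (\<ominus> b)) = a \<otimes> (\<ominus> b)"
      using assms by (simp add: a_minus_def A.m_assoc add_cancel)
    ultimately show ?thesis by simp
  qed
  show ?thesis using assms
    by (simp add: brace_lambda_def left_distrib 1 a_minus_def A.m_assoc add_cancel m_assoc)
qed

lemma lambda_one:
  assumes "a \<in> carrier B"
  shows "brace_lambda B \<one> a = a"
proof -
  have "\<ominus> \<one> = \<zero>"
    using A.inv_one by (simp only: zero_eq_one)
  then show ?thesis
    using assms by (simp add: brace_lambda_def)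
qed

lemma brace_ideal_center: "brace_ideal B (brace_center B)"
proof -
  let ?Z = "brace_center B"
  have closed: "z \<in> carrier B" if "z \<in> ?Z" for z
    using that by (simp add: brace_center_def group_center_def)
  have add_comm: "z \<oplus> x = x \<oplus> z" if "z \<in> ?Z" "x \<in> carrier B" for z x
    using that by (simp add: brace_center_def group_center_def)
  have mult_comm: "z \<otimes> x = x \<otimes> z" if "z \<in> ?Z" "x \<in> carrier B" for z x
    using that by (simp add: brace_center_def group_center_def)
  have lambda: "brace_lambda B z x = x" if "z \<in> ?Z" "x \<in> carrier B" for z x
    using that by (simp add: brace_center_def)
  have centerI: "z \<in> ?Z" if "z \<in> carrier B" "\<And>x. x \<in> carrier B \<Longrightarrow> z \<oplus> x = x \<oplus> z"
    "\<And>x. x \<in> carrier B \<Longrightarrow> z \<otimes> x = x \<otimes> z" "\<And>x. x \<in> carrier B \<Longrightarrow> brace_lambda B z x = x" for z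
    using that by (auto simp: brace_center_def group_center_def)
  have mult_eq_add: "z \<otimes> x = z \<oplus> x" if "z \<in> ?Z" "x \<in> carrier B" for z x
    using mult_eq_add_lambda[of z x] lambda[OF that] closed[OF that(1)] that(2) by simp
  have m_inv_eq: "inv z = \<ominus> z" if "z \<in> ?Z" for z
  proof -
    have "z \<oplus> inv z = \<zero>"
      using mult_eq_add[OF that, of "inv z"] closed[OF that] zero_eq_one by simp
    then show ?thesis
      using add_cancel(1)[of z "inv z"] closed[OF that] by simp
  qed
  have sub: "subgroup ?Z B"
  proof
    show "?Z \<subseteq> carrier B" using closed by blast
    show "x \<otimes> y \<in> ?Z" if Zx: "x \<in> ?Z" and Zy: "y \<in> ?Z" for x y
    proof (rule centerI)
      note c = closed[OF Zx] closed[OF Zy]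
      show "x \<otimes> y \<in> carrier B" using c by simp
      fix a assume a: "a \<in> carrier B"
      show "x \<otimes> y \<oplus> a = a \<oplus> x \<otimes> y"
        unfolding mult_eq_add[OF Zx c(2)]
        by (metis a c A.m_assoc add_comm[OF Zx] add_comm[OF Zy])
      show "x \<otimes> y \<otimes> a = a \<otimes> (x \<otimes> y)"
        by (metis a c m_assoc mult_comm[OF Zx] mult_comm[OF Zy])
      show "brace_lambda B (x \<otimes> y) a = a"
        using a c by (simp add: lambda_mult[symmetric] lambda[OF Zx] lambda[OF Zy])
    qed
    show "\<one> \<in> ?Z"
    proof (rule centerI)
      show "\<one> \<oplus> x = x \<oplus> \<one>" if "x \<in> carrier B" for x
        using that A.l_one[of x] A.r_one[of x] unfolding zero_eq_one by simp
    qed (simp_all add: lambda_one)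
    show "inv x \<in> ?Z" if Zx: "x \<in> ?Z" for x
    proof (rule centerI)
      note c = closed[OF Zx]
      show "inv x \<in> carrier B" using c by simp
      fix a assume a: "a \<in> carrier B"
      have "a \<oplus> \<ominus> x = \<ominus> x \<oplus> (x \<oplus> (a \<oplus> \<ominus> x))"
        using add_cancel(1)[of x "a \<oplus> \<ominus> x"] a c by simp
      also have "x \<oplus> (a \<oplus> \<ominus> x) = a"
        using add_comm[OF Zx, of "a \<oplus> \<ominus> x"] a c by (simp add: A.m_assoc)
      finally show "inv x \<oplus> a = a \<oplus> inv x"
        using m_inv_eq[OF Zx] by simp
      have "a \<otimes> inv x = inv x \<otimes> (x \<otimes> (a \<otimes> inv x))"
        using a c by (simp add: m_assoc[symmetric])
      also have "x \<otimes> (a \<otimes> inv x) = a"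
        using mult_comm[OF Zx, of "a \<otimes> inv x"] a c by (simp add: m_assoc)
      finally show "inv x \<otimes> a = a \<otimes> inv x" by simp
      show "brace_lambda B (inv x) a = a"
        using lambda_mult[of "inv x" x a] a c by (simp add: lambda[OF Zx] lambda_one)
    qed
  qed
  have "?Z \<lhd> B"
    unfolding normal_inv_iff
  proof (intro conjI ballI)
    fix x z assume x: "x \<in> carrier B" and z: "z \<in> ?Z"
    have "x \<otimes> z \<otimes> inv x = z"
      using x closed[OF z] mult_comm[OF z x, symmetric] by (simp add: m_assoc)
    then show "x \<otimes> z \<otimes> inv x \<in> ?Z" using z by simp
  qed (fact sub)
  moreover have add_sub: "subgroup ?Z (add_monoid B)"
  proof
    show "?Z \<subseteq> carrier (add_monoid B)" using closed by auto
    show "\<one>\<^bsub>add_monoid B\<^esub> \<in> ?Z"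
      using subgroup.one_closed[OF sub] by (simp add: zero_eq_one)
    show "x \<otimes>\<^bsub>add_monoid B\<^esub> y \<in> ?Z" if "x \<in> ?Z" "y \<in> ?Z" for x y
      using subgroup.m_closed[OF sub that] mult_eq_add[OF that(1) closed[OF that(2)]] by simp
    show "inv\<^bsub>add_monoid B\<^esub> x \<in> ?Z" if "x \<in> ?Z" for x
      using subgroup.m_inv_closed[OF sub that] m_inv_eq[OF that] by (simp add: a_inv_def)
  qed
  have "?Z \<lhd> add_monoid B"
    unfolding A.normal_inv_iff
  proof (intro conjI ballI)
    fix x z assume x: "x \<in> carrier B" and z: "z \<in> ?Z"
    have "x \<oplus> z \<oplus> \<ominus> x = z"
      using x closed[OF z] add_comm[OF z x, symmetric] by (simp add: A.m_assoc)
    then show "x \<oplus> z \<oplus> \<ominus> x \<in> ?Z" using z by simp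
  qed (fact add_sub)
  moreover have "brace_lambda B b z \<in> ?Z" if z: "z \<in> ?Z" and b: "b \<in> carrier B" for b z
  proof -
    have "b \<otimes> z = b \<oplus> z"
      using mult_eq_add[OF z b] mult_comm[OF z b] add_comm[OF z b] by simp
    then show ?thesis
      using z b closed[OF z] add_cancel(1)[of b z] by (simp add: brace_lambda_def)
  qed
  ultimately show ?thesis by (auto simp: brace_ideal_def)
qed

lemma rcoset_eq:
  assumes I: "brace_ideal B I" and a: "a \<in> carrier B"
  shows "I +> a = I #> a"
proof -
  interpret N: normal I B using I by (simp add: brace_ideal_def)
  have add_normal: "I \<lhd> add_monoid B" using I by (simp add: brace_ideal_def)
  have lam: "brace_lambda B b x \<in> I" if "b \<in> carrier B" "x \<in> I" for b x
    using I that by (auto simp: brace_ideal_def)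
  have "l_coset B a I = a <+ I"
  proof (intro equalityI subsetI)
    fix x assume "x \<in> l_coset B a I"
    then obtain i where "i \<in> I" "x = a \<otimes> i" by (auto simp: l_coset_def)
    then show "x \<in> a <+ I"
      using mult_eq_add_lambda[of a i] lam[OF a] a by (auto simp: a_l_coset_def')
  next
    fix x assume "x \<in> a <+ I"
    then obtain i where i: "i \<in> I" "x = a \<oplus> i" by (auto simp: a_l_coset_def')
    let ?j = "brace_lambda B (inv a) i"
    have "?j \<in> I" using lam a i by simp
    moreover have "a \<otimes> ?j = x"
      using a i lambda_mult[of a "inv a" i] mult_eq_add_lambda[of a ?j] N.mem_carrier
      by (simp add: lambda_one lambda_closed)
    ultimately show "x \<in> l_coset B a I" by (auto simp: l_coset_def)
  qed
  moreover have "I #> a = l_coset B a I" using N.coset_eq a by simp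
  moreover have "I +> a = a <+ I"
    using normal.coset_eq[OF add_normal] a by (simp add: a_r_coset_def a_l_coset_def)
  ultimately show ?thesis by simp
qed

lemma skew_brace_Quot:
  assumes I: "brace_ideal B I"
  shows "skew_brace (B Quot I)"
proof -
  interpret N: normal I B using I by (simp add: brace_ideal_def)
  have add_normal: "I \<lhd> add_monoid B" using I by (simp add: brace_ideal_def)
  interpret AN: normal I "add_monoid B" by (fact add_normal)
  have carrier_Q: "carrier (B Quot I) = (\<lambda>a. I +> a) ` carrier B"
    by (auto simp: FactRing_def A_RCOSETS_def RCOSETS_def a_r_coset_def)
  have mult_Q: "(I +> a) \<otimes>\<^bsub>B Quot I\<^esub> (I +> b) = I +> a \<otimes> b"
    if "a \<in> carrier B" "b \<in> carrier B" for a b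
  proof -
    have "I +> x \<otimes> y = I +> a \<otimes> b" if "x \<in> I +> a" "y \<in> I +> b" for x y
    proof -
      have "x \<in> I #> a" "y \<in> I #> b"
        using that \<open>a \<in> carrier B\<close> \<open>b \<in> carrier B\<close> rcoset_eq[OF I] by auto
      then have "x \<otimes> y \<in> I #> a \<otimes> b"
        using N.rcos_sum[of a b] \<open>a \<in> carrier B\<close> \<open>b \<in> carrier B\<close> unfolding set_mult_def by blast
      then show ?thesis
        using repr_independence[OF _ _ N.is_subgroup, of "x \<otimes> y" "a \<otimes> b"]
          r_coset_subset_G[OF N.subset, of "a \<otimes> b"] \<open>a \<in> carrier B\<close> \<open>b \<in> carrier B\<close>
        by (simp add: rcoset_eq[OF I] subset_iff)
    qed
    moreover have "a \<in> I +> a" "b \<in> I +> b"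
      using that rcoset_eq[OF I] rcos_self[OF _ N.is_subgroup] by simp_all
    ultimately have "(\<Union>x\<in>I +> a. \<Union>y\<in>I +> b. I +> x \<otimes> y) = I +> a \<otimes> b"
      by blast
    then show ?thesis
      by (simp add: FactRing_def rcoset_mult_def)
  qed
  have add_Q: "(I +> a) \<oplus>\<^bsub>B Quot I\<^esub> (I +> b) = I +> a \<oplus> b"
    if "a \<in> carrier B" "b \<in> carrier B" for a b
    using AN.rcos_sum[of a b] that by (simp add: FactRing_def set_add_def a_r_coset_def)
  have one_Q: "\<one>\<^bsub>B Quot I\<^esub> = I +> \<one>" by (simp add: FactRing_def)
  have group_Q: "group (B Quot I)"
  proof (rule groupI)
    show "\<exists>y\<in>carrier (B Quot I). y \<otimes>\<^bsub>B Quot I\<^esub> x = \<one>\<^bsub>B Quot I\<^esub>" if x: "x \<in> carrier (B Quot I)" for x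
    proof -
      obtain a where "a \<in> carrier B" "x = I +> a" using x by (auto simp: carrier_Q)
      then show ?thesis
        by (intro bexI[of _ "I +> inv a"]) (auto simp: carrier_Q mult_Q one_Q)
    qed
  qed (auto simp: carrier_Q mult_Q one_Q m_assoc)
  have add_group_Q: "group (add_monoid (B Quot I))"
  proof -
    have "add_monoid (B Quot I) = add_monoid B Mod I"
      by (simp add: FactRing_def FactGroup_def A_RCOSETS_def set_add_def)
    then show ?thesis using AN.factorgroup_is_group by simp
  qed
  interpret AQ: group "add_monoid (B Quot I)" by (fact add_group_Q)
  have minus_Q: "\<ominus>\<^bsub>B Quot I\<^esub> (I +> a) = I +> \<ominus> a" if "a \<in> carrier B" for a
  proof -
    have "(I +> \<ominus> a) \<oplus>\<^bsub>B Quot I\<^esub> (I +> a) = \<zero>\<^bsub>B Quot I\<^esub>"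
      using that add_Q[of "\<ominus> a" a] A.coset_mult_one[of I] N.subset by (simp add: FactRing_def)
    then show ?thesis
      using that AQ.inv_equality[of "I +> \<ominus> a" "I +> a"] by (simp add: a_inv_def[of "B Quot I"] carrier_Q)
  qed
  show ?thesis
  proof (intro skew_brace.intro skew_brace_axioms.intro group_Q add_group_Q)
    fix x y z
    assume "x \<in> carrier (B Quot I)" "y \<in> carrier (B Quot I)" "z \<in> carrier (B Quot I)"
    then obtain a b c where "a \<in> carrier B" "x = I +> a" "b \<in> carrier B" "y = I +> b"
      "c \<in> carrier B" "z = I +> c" by (auto simp: carrier_Q)
    then show "x \<otimes>\<^bsub>B Quot I\<^esub> (y \<oplus>\<^bsub>B Quot I\<^esub> z) =
        x \<otimes>\<^bsub>B Quot I\<^esub> y \<ominus>\<^bsub>B Quot I\<^esub> x \<oplus>\<^bsub>B Quot I\<^esub> x \<otimes>\<^bsub>B Quot I\<^esub> z"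
      by (simp add: a_minus_def add_Q mult_Q minus_Q left_distrib)
  qed
qed

end

end

theory Submission
  imports Defs
begin

text \<open>
  Write \<open>a * b = - a + ab - b\<close>. Expanding \<open>(a + c)(d + b)\<close> in two ways shows that every \<open>a * b\<close>
  commutes additively with every \<open>- d + cd - c\<close>, the star product of the opposite skew brace. Since
  multiplicative conjugations of a two-sided skew brace are automorphisms, the additive centralizer
  \<open>C\<close> of all \<open>a * b\<close> is an ideal, and it contains all opposite star products. In a quasi-simple
  situation \<open>C\<close> is everything or central, and the same holds for the opposite skew brace. It follows
  that all star products of \<open>B\<close> or of its opposite are additively central; the only exception would
  be that both centralizers lie in the multiplicative center, but then multiplicative commutators are
  central and perfectness gives \<open>B = 0\<close>.

  If all star products are additively central, then \<open>*\<close> is additive in both arguments. If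
  \<open>(B, +)\<close> is perfect, this already gives \<open>* = 0\<close>. Otherwise note that \<open>B\<close> acts on the additive center
  through a finite radical ring; Nakayama's lemma and perfectness again force \<open>* = 0\<close>. So \<open>B\<close>
  is trivial. For the opposite skew brace the
  conclusion says that \<open>B\<close> is almost trivial.
\<close>

section \<open>Star products and the opposite skew brace\<close>

definition brace_star :: "('a, 'b) ring_scheme \<Rightarrow> 'a \<Rightarrow> 'a \<Rightarrow> 'a" where
  "brace_star B a b = brace_lambda B a b \<ominus>\<^bsub>B\<^esub> b"

definition star_centralizer :: "('a, 'b) ring_scheme \<Rightarrow> 'a set" where
  "star_centralizer B = {x \<in> carrier B. \<forall>a\<in>carrier B. \<forall>b\<in>carrier B.
     x \<oplus>\<^bsub>B\<^esub> brace_star B a b = brace_star B a b \<oplus>\<^bsub>B\<^esub> x}"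

text \<open>Reversing only the addition exchanges "almost trivial" with "trivial", so a result about
  \<open>B\<close> yields its mirror image when applied to \<open>opposite B\<close>.\<close>

definition opposite :: "('a, 'b) ring_scheme \<Rightarrow> ('a, 'b) ring_scheme" where
  "opposite B = B\<lparr>add := \<lambda>x y. y \<oplus>\<^bsub>B\<^esub> x\<rparr>"

text \<open>The definite description behind \<open>m_inv\<close> asks for a two-sided inverse, so
  reversing the addition merely swaps its two equations. Negation therefore stays the same, for any
  record.\<close>

lemma opposite_simps [simp]:
  "carrier (opposite B) = carrier B"
  "monoid.mult (opposite B) = monoid.mult B"
  "one (opposite B) = one B"
  "zero (opposite B) = zero B"
  "x \<oplus>\<^bsub>opposite B\<^esub> y = y \<oplus>\<^bsub>B\<^esub> x"
  "m_inv (opposite B) = m_inv B"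
  "a_inv (opposite B) = a_inv B"
  "x \<ominus>\<^bsub>opposite B\<^esub> y = \<ominus>\<^bsub>B\<^esub> y \<oplus>\<^bsub>B\<^esub> x"
proof -
  show *: "a_inv (opposite B) = a_inv B"
    by (auto simp: opposite_def a_inv_def m_inv_def fun_eq_iff intro!: arg_cong[where f = The])
  show "x \<ominus>\<^bsub>opposite B\<^esub> y = \<ominus>\<^bsub>B\<^esub> y \<oplus>\<^bsub>B\<^esub> x"
    unfolding a_minus_def * by (simp add: opposite_def)
qed (auto simp: opposite_def m_inv_def fun_eq_iff)

lemma opposite_opposite [simp]: "opposite (opposite B) = B"
  by (simp add: opposite_def)

lemma subgroup_opposite [simp]: "subgroup H (opposite B) \<longleftrightarrow> subgroup H B"
  by (simp add: subgroup_def)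

lemma subgroup_add_opposite:
  "subgroup H (add_monoid (opposite B)) \<longleftrightarrow> subgroup H (add_monoid B)"
  using opposite_simps(7)[of B] by (auto simp: subgroup_def a_inv_def)

lemma group_center_opposite [simp]: "group_center (opposite B) = group_center B"
  by (simp add: group_center_def)

lemma group_center_add_opposite:
  "group_center (add_monoid (opposite B)) = group_center (add_monoid B)"
  by (auto simp: group_center_def)

sublocale skew_brace \<subseteq> A: group "add_monoid B"
  rewrites "carrier (add_monoid B) = carrier B"
    and "monoid.mult (add_monoid B) = add B"
    and "one (add_monoid B) = zero B"
    and "m_inv (add_monoid B) = a_inv B"
    and "r_coset (add_monoid B) = a_r_coset B"
    and "l_coset (add_monoid B) = a_l_coset B"
    and "set_mult (add_monoid B) = set_add B"
    and "RCOSETS (add_monoid B) = A_RCOSETS B"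
  by (rule add_group) (auto simp: a_inv_def a_r_coset_def a_l_coset_def set_add_def A_RCOSETS_def fun_eq_iff)

section \<open>Identities for lambda and star, ideals, and passage to the opposite\<close>

context skew_brace
begin

lemma zero_mult [simp]:
  assumes "a \<in> carrier B"
  shows "\<zero> \<otimes> a = a" "a \<otimes> \<zero> = a" "inv \<zero> = \<zero>"
  using assms by (simp_all add: zero_eq_one)

lemmas brace_simps = a_minus_def A.m_assoc add_cancel A.inv_mult_group zero_eq_one[symmetric]

lemma lambda_add:
  "\<lbrakk>a \<in> carrier B; b \<in> carrier B; c \<in> carrier B\<rbrakk> \<Longrightarrow>
    brace_lambda B a (b \<oplus> c) = brace_lambda B a b \<oplus> brace_lambda B a c"
  by (simp add: brace_lambda_def left_distrib brace_simps)

lemma lambda_zero [simp]: "a \<in> carrier B \<Longrightarrow> brace_lambda B a \<zero> = \<zero>"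
  by (simp add: brace_lambda_def)

lemma lambda_minus:
  assumes "a \<in> carrier B" "b \<in> carrier B"
  shows "brace_lambda B a (\<ominus> b) = \<ominus> brace_lambda B a b"
  using lambda_add[of a b "\<ominus> b"] assms
  by (metis A.inv_closed A.inv_equality A.inv_inv A.r_inv lambda_closed lambda_zero)

lemma lambda_inv_cancel:
  "\<lbrakk>a \<in> carrier B; b \<in> carrier B\<rbrakk> \<Longrightarrow> brace_lambda B (inv a) (brace_lambda B a b) = b"
  "\<lbrakk>a \<in> carrier B; b \<in> carrier B\<rbrakk> \<Longrightarrow> brace_lambda B a (brace_lambda B (inv a) b) = b"
  by (simp_all add: lambda_mult lambda_one)

lemma star_closed [simp]: "\<lbrakk>a \<in> carrier B; b \<in> carrier B\<rbrakk> \<Longrightarrow> brace_star B a b \<in> carrier B"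
  by (simp add: brace_star_def lambda_closed a_minus_def)

lemma lambda_eq_star_add:
  "\<lbrakk>a \<in> carrier B; b \<in> carrier B\<rbrakk> \<Longrightarrow> brace_lambda B a b = brace_star B a b \<oplus> b"
  by (simp add: brace_star_def lambda_closed brace_simps)

lemma mult_eq_star:
  "\<lbrakk>a \<in> carrier B; b \<in> carrier B\<rbrakk> \<Longrightarrow> a \<otimes> b = a \<oplus> brace_star B a b \<oplus> b"
  by (simp add: mult_eq_add_lambda lambda_eq_star_add A.m_assoc)

text \<open>Lambda is an action of the multiplicative group by additive automorphisms, so
  \<open>lambda_c lambda_a = lambda_(c a inv c) lambda_c\<close>. Hence the set of star products is
  stable under every lambda map.\<close>

lemma lambda_star:
  assumes "a \<in> carrier B" "b \<in> carrier B" "c \<in> carrier B"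
  shows "brace_lambda B c (brace_star B a b) = brace_star B (c \<otimes> a \<otimes> inv c) (brace_lambda B c b)"
  using assms
  by (simp add: brace_star_def a_minus_def lambda_add lambda_minus lambda_closed lambda_mult m_assoc)

lemma star_opposite: "\<lbrakk>a \<in> carrier B; b \<in> carrier B\<rbrakk> \<Longrightarrow>
  brace_star (opposite B) a b = \<ominus> b \<oplus> a \<otimes> b \<ominus> a"
  by (simp add: brace_star_def brace_lambda_def brace_simps)

lemma mult_eq_star_opposite:
  "\<lbrakk>a \<in> carrier B; b \<in> carrier B\<rbrakk> \<Longrightarrow> a \<otimes> b = b \<oplus> brace_star (opposite B) a b \<oplus> a"
  by (simp add: star_opposite brace_simps)

lemma trivial_skew_braceI:
  assumes "\<And>a b. \<lbrakk>a \<in> carrier B; b \<in> carrier B\<rbrakk> \<Longrightarrow> brace_star B a b = \<zero>"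
  shows "trivial_skew_brace B"
  using assms skew_brace_axioms by (simp add: trivial_skew_brace_def mult_eq_star)

lemma skew_brace_opposite: "skew_brace (opposite B)"
proof -
  have "group (opposite B)"
    by (rule groupI) (auto simp: m_assoc intro: l_inv_ex)
  moreover have "group (add_monoid (opposite B))"
    by (rule groupI) (auto simp: A.m_assoc intro: A.r_inv_ex)
  ultimately show ?thesis
    by (intro skew_brace.intro skew_brace_axioms.intro) (simp_all add: left_distrib brace_simps)
qed

text \<open>Multiplicative closure comes from the additive one: \<open>xy = x + lambda_x y\<close>,
  and \<open>inv x = lambda_(inv x) (- x)\<close> because \<open>x\<close> times the right-hand side
  is \<open>x - x\<close>.\<close>

lemma brace_idealI:
  assumes sub: "subgroup I (add_monoid B)"
    and add_conj: "\<And>x i. \<lbrakk>x \<in> carrier B; i \<in> I\<rbrakk> \<Longrightarrow> x \<oplus> i \<ominus> x \<in> I"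
    and lam: "\<And>x i. \<lbrakk>x \<in> carrier B; i \<in> I\<rbrakk> \<Longrightarrow> brace_lambda B x i \<in> I"
    and conj: "\<And>x i. \<lbrakk>x \<in> carrier B; i \<in> I\<rbrakk> \<Longrightarrow> x \<otimes> i \<otimes> inv x \<in> I"
  shows "brace_ideal B I"
proof -
  note closed = subgroup.mem_carrier[OF sub, simplified]
  have "subgroup I B"
  proof
    show "I \<subseteq> carrier B" using closed by blast
    show "x \<otimes> y \<in> I" if "x \<in> I" "y \<in> I" for x y
      using that subgroup.m_closed[OF sub, of x "brace_lambda B x y"] lam closed
      by (simp add: mult_eq_add_lambda)
    show "\<one> \<in> I"
      using subgroup.one_closed[OF sub] by (simp add: zero_eq_one)
    show "inv x \<in> I" if x: "x \<in> I" for x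
    proof -
      have "x \<otimes> brace_lambda B (inv x) (\<ominus> x) = \<zero>"
        using closed[OF x] by (simp add: mult_eq_add_lambda lambda_closed lambda_inv_cancel)
      then have "inv x = brace_lambda B (inv x) (\<ominus> x)"
        using closed[OF x] by (metis A.inv_closed inv_closed inv_equality inv_inv lambda_closed zero_eq_one)
      moreover have "\<ominus> x \<in> I"
        using subgroup.m_inv_closed[OF sub x] by (simp add: a_inv_def)
      ultimately show ?thesis
        using lam[of "inv x" "\<ominus> x"] closed[OF x] by simp
    qed
  qed
  then show ?thesis
    using assms by (auto simp: brace_ideal_def normal_inv_iff A.normal_inv_iff a_minus_def)
qed

lemma
  assumes "brace_ideal B I"
  shows ideal_add_subgroup: "subgroup I (add_monoid B)"
    and ideal_closed: "i \<in> I \<Longrightarrow> i \<in> carrier B"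
    and ideal_lambda: "\<lbrakk>x \<in> carrier B; i \<in> I\<rbrakk> \<Longrightarrow> brace_lambda B x i \<in> I"
    and ideal_conj: "\<lbrakk>x \<in> carrier B; i \<in> I\<rbrakk> \<Longrightarrow> x \<otimes> i \<otimes> inv x \<in> I"
    and ideal_add_conj: "\<lbrakk>x \<in> carrier B; i \<in> I\<rbrakk> \<Longrightarrow> x \<oplus> i \<ominus> x \<in> I"
    and ideal_add: "\<lbrakk>i \<in> I; j \<in> I\<rbrakk> \<Longrightarrow> i \<oplus> j \<in> I"
    and ideal_minus: "i \<in> I \<Longrightarrow> \<ominus> i \<in> I"
  using assms subgroup.m_closed[of I "add_monoid B"] subgroup.m_inv_closed[of I "add_monoid B"]
  by (auto simp: brace_ideal_def normal_inv_iff A.normal_inv_iff subgroup.mem_carrier a_minus_def a_inv_def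
      image_subset_iff)

text \<open>The opposite lambda map sends \<open>i\<close> to \<open>x + lambda_x i - x\<close>, an
  additive conjugate of \<open>lambda_x i\<close>. Since \<open>opposite\<close> is an involution,
  both skew braces have the same ideals.\<close>

lemma ideal_opposite:
  assumes "brace_ideal B I"
  shows "brace_ideal (opposite B) I"
proof (rule skew_brace.brace_idealI[OF skew_brace_opposite])
  note c = ideal_closed[OF assms]
  fix x i assume x: "x \<in> carrier (opposite B)" and i: "i \<in> I"
  show "x \<oplus>\<^bsub>opposite B\<^esub> i \<ominus>\<^bsub>opposite B\<^esub> x \<in> I"
    using ideal_add_conj[OF assms, of "\<ominus> x" i] x i c by (simp add: brace_simps)
  have "brace_lambda (opposite B) x i = x \<oplus> brace_lambda B x i \<ominus> x"
    using x i c by (simp add: brace_lambda_def brace_simps)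
  then show "brace_lambda (opposite B) x i \<in> I"
    using ideal_add_conj[OF assms] ideal_lambda[OF assms] x i by simp
  show "x \<otimes>\<^bsub>opposite B\<^esub> i \<otimes>\<^bsub>opposite B\<^esub> inv\<^bsub>opposite B\<^esub> x \<in> I"
    using ideal_conj[OF assms] x i by simp
qed (use ideal_add_subgroup[OF assms] subgroup_add_opposite in blast)

end

section \<open>Consequences of right distributivity\<close>

context two_sided_skew_brace
begin

lemma two_sided_skew_brace_opposite: "two_sided_skew_brace (opposite B)"
  by (intro two_sided_skew_brace.intro two_sided_skew_brace_axioms.intro skew_brace_opposite)
    (simp add: right_distrib brace_simps)

lemma minus_mult:
  assumes "a \<in> carrier B" "c \<in> carrier B"
  shows "(\<ominus> a) \<otimes> c = c \<ominus> a \<otimes> c \<oplus> c"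
proof -
  have "c = a \<otimes> c \<ominus> c \<oplus> (\<ominus> a) \<otimes> c"
    using right_distrib[of a "\<ominus> a" c] assms by simp
  then have "c \<ominus> a \<otimes> c \<oplus> c = c \<ominus> a \<otimes> c \<oplus> (a \<otimes> c \<ominus> c \<oplus> (\<ominus> a) \<otimes> c)"
    by simp
  then show ?thesis using assms by (simp add: brace_simps)
qed

text \<open>Expanding by both distributive laws leaves \<open>- inv x + (- x)(inv x) - inv x\<close>
  in the middle, which vanishes since \<open>(- x)(inv x) = inv x + inv x\<close>. So multiplicative
  conjugation is an automorphism of the skew brace and respects lambda and star.\<close>

lemma conj_add:
  assumes "x \<in> carrier B" "a \<in> carrier B" "b \<in> carrier B"
  shows "x \<otimes> (a \<oplus> b) \<otimes> inv x = x \<otimes> a \<otimes> inv x \<oplus> x \<otimes> b \<otimes> inv x"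
  using assms by (simp add: left_distrib right_distrib minus_mult a_minus_def)
    (simp add: brace_simps)

lemma conj_minus:
  assumes "x \<in> carrier B" "a \<in> carrier B"
  shows "x \<otimes> (\<ominus> a) \<otimes> inv x = \<ominus> (x \<otimes> a \<otimes> inv x)"
proof -
  have "x \<otimes> (\<ominus> a) \<otimes> inv x \<oplus> x \<otimes> a \<otimes> inv x = \<zero>"
    using conj_add[of x "\<ominus> a" a] assms by (simp add: zero_eq_one)
  then show ?thesis using assms by (intro A.inv_equality[symmetric]) auto
qed

lemma conj_lambda:
  assumes "x \<in> carrier B" "a \<in> carrier B" "b \<in> carrier B"
  shows "x \<otimes> brace_lambda B a b \<otimes> inv x = brace_lambda B (x \<otimes> a \<otimes> inv x) (x \<otimes> b \<otimes> inv x)"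
proof -
  have "inv x \<otimes> (x \<otimes> c) = c" if "c \<in> carrier B" for c
    using assms that by (simp add: m_assoc[symmetric])
  then show ?thesis
    using assms by (simp add: brace_lambda_def conj_add conj_minus) (simp add: m_assoc)
qed

lemma conj_star:
  assumes "x \<in> carrier B" "a \<in> carrier B" "b \<in> carrier B"
  shows "x \<otimes> brace_star B a b \<otimes> inv x = brace_star B (x \<otimes> a \<otimes> inv x) (x \<otimes> b \<otimes> inv x)"
  using assms by (simp add: brace_star_def a_minus_def conj_add conj_minus conj_lambda lambda_closed)

text \<open>Expand \<open>(a \<oplus> c) \<otimes> (d \<oplus> b)\<close> with the two distributive laws in both possible orders.\<close>
lemma star_commutes_star_opposite:
  assumes "a \<in> carrier B" "b \<in> carrier B" "c \<in> carrier B" "d \<in> carrier B"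
  shows "brace_star (opposite B) c d \<oplus> brace_star B a b = brace_star B a b \<oplus> brace_star (opposite B) c d"
proof -
  have "(a \<oplus> c) \<otimes> (d \<oplus> b) = a \<otimes> d \<ominus> d \<oplus> c \<otimes> d \<ominus> c \<ominus> a \<oplus> a \<otimes> b \<ominus> b \<oplus> c \<otimes> b"
    using assms by (simp add: left_distrib) (simp add: right_distrib brace_simps)
  moreover have "(a \<oplus> c) \<otimes> (d \<oplus> b) = a \<otimes> d \<ominus> a \<oplus> a \<otimes> b \<ominus> b \<ominus> d \<oplus> c \<otimes> d \<ominus> c \<oplus> c \<otimes> b"
    using assms by (simp add: right_distrib) (simp add: left_distrib brace_simps)
  ultimately have "a \<otimes> d \<ominus> d \<oplus> c \<otimes> d \<ominus> c \<ominus> a \<oplus> a \<otimes> b \<ominus> b \<oplus> c \<otimes> b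
      = a \<otimes> d \<ominus> a \<oplus> a \<otimes> b \<ominus> b \<ominus> d \<oplus> c \<otimes> d \<ominus> c \<oplus> c \<otimes> b"
    by simp
  \<comment> \<open>Cancel \<open>cb\<close> on the right here and \<open>ad\<close> on the left
    afterwards: what remains are the blocks \<open>- d + cd - c\<close> and
    \<open>- a + ab - b\<close> in the two possible orders.\<close>
  then have "a \<otimes> d \<ominus> d \<oplus> c \<otimes> d \<ominus> c \<ominus> a \<oplus> a \<otimes> b \<ominus> b
      = a \<otimes> d \<ominus> a \<oplus> a \<otimes> b \<ominus> b \<ominus> d \<oplus> c \<otimes> d \<ominus> c"
    using assms by (simp add: a_minus_def)
  then show ?thesis
    using assms by (simp add: star_opposite brace_star_def brace_lambda_def) (simp add: brace_simps)
qed

end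

section \<open>Additively central star products\<close>

text \<open>Left ideals without any normality: the submodules for the lambda action with which the
  Nakayama argument works.\<close>

definition left_brace_ideal :: "('a, 'b) ring_scheme \<Rightarrow> 'a set \<Rightarrow> bool" where
  "left_brace_ideal B I \<longleftrightarrow> subgroup I (add_monoid B) \<and>
    (\<forall>a\<in>carrier B. \<forall>i\<in>I. brace_lambda B a i \<in> I)"

definition star_central :: "('a, 'b) ring_scheme \<Rightarrow> bool" where
  "star_central B \<longleftrightarrow> (\<forall>a\<in>carrier B. \<forall>b\<in>carrier B.
    brace_star B a b \<in> group_center (add_monoid B))"

text \<open>Equivalently, these are the common fixed points of all lambda maps.\<close>

definition star_annihilator :: "('a, 'b) ring_scheme \<Rightarrow> 'a set" where
  "star_annihilator B = {d \<in> carrier B. \<forall>a\<in>carrier B. brace_star B a d = \<zero>\<^bsub>B\<^esub>}"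

text \<open>The form in which perfectness of a group is applied: a property holds everywhere once it
  defines a subgroup and holds for commutators.\<close>

lemma (in group) carrier_eq_of_derived_set_subset:
  assumes "derived G (carrier G) = carrier G" "subgroup H G" "derived_set G (carrier G) \<subseteq> H"
  shows "H = carrier G"
  using assms generate_subgroup_incl[of "derived_set G (carrier G)" H] subgroup.subset
  unfolding derived_def by blast

section \<open>Left ideals and additivity of the star in its second argument\<close>

context skew_brace
begin

lemma
  assumes "left_brace_ideal B I"
  shows left_ideal_subgroup: "subgroup I (add_monoid B)"
    and left_ideal_closed: "i \<in> I \<Longrightarrow> i \<in> carrier B"
    and left_ideal_zero: "\<zero> \<in> I"
    and left_ideal_add: "\<lbrakk>i \<in> I; j \<in> I\<rbrakk> \<Longrightarrow> i \<oplus> j \<in> I"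
    and left_ideal_minus: "i \<in> I \<Longrightarrow> \<ominus> i \<in> I"
    and left_ideal_lambda: "\<lbrakk>a \<in> carrier B; i \<in> I\<rbrakk> \<Longrightarrow> brace_lambda B a i \<in> I"
  using assms subgroup.m_closed[of I "add_monoid B"] subgroup.m_inv_closed[of I "add_monoid B"]
    subgroup.one_closed[of I "add_monoid B"] subgroup.subset[of I "add_monoid B"]
  by (auto simp: left_brace_ideal_def a_inv_def)

lemma left_ideal_star:
  assumes "left_brace_ideal B I" "a \<in> carrier B" "i \<in> I"
  shows "brace_star B a i \<in> I"
  using assms left_ideal_lambda left_ideal_minus left_ideal_add
  by (simp add: brace_star_def a_minus_def)

lemma left_idealI:
  assumes "I \<subseteq> carrier B" "\<zero> \<in> I" "\<And>x y. \<lbrakk>x \<in> I; y \<in> I\<rbrakk> \<Longrightarrow> x \<oplus> y \<in> I"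
    "\<And>x. x \<in> I \<Longrightarrow> \<ominus> x \<in> I"
    "\<And>a x. \<lbrakk>a \<in> carrier B; x \<in> I\<rbrakk> \<Longrightarrow> brace_lambda B a x \<in> I"
  shows "left_brace_ideal B I"
proof -
  have "subgroup I (add_monoid B)"
    using assms by (intro A.subgroupI) auto
  then show ?thesis using assms by (simp add: left_brace_ideal_def)
qed

lemma
  assumes "z \<in> group_center (add_monoid B)"
  shows center_closed: "z \<in> carrier B"
    and center_add_commute: "x \<in> carrier B \<Longrightarrow> z \<oplus> x = x \<oplus> z"
    and center_add_left_commute: "\<lbrakk>x \<in> carrier B; y \<in> carrier B\<rbrakk> \<Longrightarrow> z \<oplus> (x \<oplus> y) = x \<oplus> (z \<oplus> y)"
proof -
  show c: "z \<in> carrier B"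
    using assms by (auto simp: group_center_def)
  show comm: "z \<oplus> x = x \<oplus> z" if "x \<in> carrier B" for x
    using assms that by (auto simp: group_center_def)
  show "z \<oplus> (x \<oplus> y) = x \<oplus> (z \<oplus> y)" if "x \<in> carrier B" "y \<in> carrier B"
    using comm[of x] c that by (simp add: A.m_assoc[symmetric])
qed

lemma add_commute_minus:
  assumes "x \<in> carrier B" "s \<in> carrier B" "x \<oplus> s = s \<oplus> x"
  shows "x \<oplus> \<ominus> s = \<ominus> s \<oplus> x"
proof -
  have "\<ominus> s \<oplus> (x \<oplus> s) \<oplus> \<ominus> s = \<ominus> s \<oplus> (s \<oplus> x) \<oplus> \<ominus> s"
    using assms by simp
  then show ?thesis using assms(1,2) by (simp add: brace_simps)
qed

lemma star_zero_right [simp]: "a \<in> carrier B \<Longrightarrow> brace_star B a \<zero> = \<zero>"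
  by (simp add: brace_star_def a_minus_def)

lemma star_add_right':
  assumes "a \<in> carrier B" "b \<in> carrier B" "c \<in> carrier B"
  shows "brace_star B a (b \<oplus> c) = brace_star B a b \<oplus> b \<oplus> brace_star B a c \<ominus> b"
  using assms by (simp add: brace_star_def lambda_add lambda_closed brace_simps)

text \<open>Apply \<open>lambda_a x = a * x + x\<close> twice in
  \<open>lambda_a (lambda_b c)\<close>, using additivity of \<open>lambda_a\<close>.\<close>

lemma star_mult_left:
  assumes "a \<in> carrier B" "b \<in> carrier B" "c \<in> carrier B"
  shows "brace_star B (a \<otimes> b) c = brace_star B a (brace_star B b c) \<oplus> brace_star B b c \<oplus> brace_star B a c"
  using assms by (simp add: brace_star_def lambda_mult[symmetric] lambda_add lambda_minus lambda_closed brace_simps)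

lemma star_inv_left:
  assumes "a \<in> carrier B" "b \<in> carrier B"
  shows "brace_star B (inv a) b = \<ominus> brace_lambda B (inv a) (brace_star B a b)"
  using assms by (simp add: brace_star_def lambda_add lambda_minus lambda_closed lambda_inv_cancel a_minus_def A.inv_mult_group)

text \<open>In \<open>star_add_right'\<close> the term \<open>a * c\<close> is conjugated by
  \<open>b\<close>; centrality removes the conjugation.\<close>

lemma
  assumes "star_central B" "a \<in> carrier B" "b \<in> carrier B"
  shows star_in_center: "brace_star B a b \<in> group_center (add_monoid B)"
    and star_add_right: "c \<in> carrier B \<Longrightarrow> brace_star B a (b \<oplus> c) = brace_star B a b \<oplus> brace_star B a c"
    and star_minus_right: "brace_star B a (\<ominus> b) = \<ominus> brace_star B a b"
proof -
  have *: "brace_star B x y \<in> group_center (add_monoid B)" if "x \<in> carrier B" "y \<in> carrier B" for x y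
    using assms that by (simp add: star_central_def)
  show "brace_star B a b \<in> group_center (add_monoid B)"
    using * assms by simp
  have add: "brace_star B a (b \<oplus> c) = brace_star B a b \<oplus> brace_star B a c" if "c \<in> carrier B" for c
    using that assms *[of a c] center_add_commute[of "brace_star B a c" "\<ominus> b"]
    by (simp add: star_add_right' brace_simps)
  then show "c \<in> carrier B \<Longrightarrow> brace_star B a (b \<oplus> c) = brace_star B a b \<oplus> brace_star B a c" .
  have "brace_star B a b \<oplus> brace_star B a (\<ominus> b) = \<zero>"
    using add[of "\<ominus> b"] assms by simp
  then show "brace_star B a (\<ominus> b) = \<ominus> brace_star B a b"
    using assms add_cancel(1)[of "brace_star B a b" "brace_star B a (\<ominus> b)"] by simp
qed

lemma subgroup_star_annihilator:
  assumes "star_central B"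
  shows "subgroup (star_annihilator B) (add_monoid B)"
  by (rule A.subgroupI)
    (auto simp: star_annihilator_def star_add_right[OF assms] star_minus_right[OF assms])

text \<open>For fixed \<open>a\<close> the map \<open>x \<mapsto> a * x\<close> is a homomorphism
  into the abelian additive center, so it kills commutators.\<close>

lemma add_commutator_in_star_annihilator:
  assumes "star_central B" "x \<in> carrier B" "y \<in> carrier B"
  shows "x \<oplus> y \<ominus> x \<ominus> y \<in> star_annihilator B"
proof -
  have "brace_star B a (x \<oplus> y \<ominus> x \<ominus> y) = \<zero>" if a: "a \<in> carrier B" for a
    using assms a center_add_left_commute[OF star_in_center[OF assms(1) a assms(2)]]
    by (simp add: a_minus_def star_add_right[OF assms(1)] star_minus_right[OF assms(1)] A.m_assoc add_cancel)
  then show ?thesis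
    using assms by (simp add: star_annihilator_def a_minus_def)
qed

lemma star_trivial_if_add_perfect:
  assumes central: "star_central B" and perfect: "derived (add_monoid B) (carrier B) = carrier B"
    and "a \<in> carrier B" "b \<in> carrier B"
  shows "brace_star B a b = \<zero>"
proof -
  have "derived_set (add_monoid B) (carrier B) \<subseteq> star_annihilator B"
    using add_commutator_in_star_annihilator[OF central] by (auto simp: a_minus_def a_inv_def)
  then have "star_annihilator B = carrier B"
    using A.carrier_eq_of_derived_set_subset[of "star_annihilator B"] perfect
      subgroup_star_annihilator[OF central] by (simp add: a_inv_def)
  then show ?thesis using assms by (auto simp: star_annihilator_def)
qed

text \<open>Modulo \<open>N\<close>, the map \<open>a \<mapsto> brace_star B a w\<close> is a homomorphism from the multiplicative group
  to an abelian group.\<close>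
lemma star_in_left_ideal_if_mult_perfect:
  assumes central: "star_central B" and perfect: "derived B (carrier B) = carrier B"
    and N: "left_brace_ideal B N" and W: "W \<subseteq> carrier B"
    and NN: "\<And>a b w. \<lbrakk>a \<in> carrier B; b \<in> carrier B; w \<in> W\<rbrakk> \<Longrightarrow> brace_star B a (brace_star B b w) \<in> N"
    and "a \<in> carrier B" "w \<in> W"
  shows "brace_star B a w \<in> N"
proof -
  let ?H = "{a \<in> carrier B. \<forall>w\<in>W. brace_star B a w \<in> N}"
  have sub: "subgroup ?H B"
  proof (rule subgroupI)
    have "\<one> \<in> ?H"
      using W left_ideal_zero[OF N] by (auto simp: brace_star_def lambda_one a_minus_def)
    then show "?H \<noteq> {}" by blast
    show "inv a \<in> ?H" if "a \<in> ?H" for a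
      using that W left_ideal_lambda[OF N] left_ideal_minus[OF N] by (auto simp: star_inv_left)
    show "a \<otimes> b \<in> ?H" if "a \<in> ?H" "b \<in> ?H" for a b
      using that W NN left_ideal_add[OF N] by (auto simp: star_mult_left)
  qed auto
  have "a \<otimes> b \<otimes> inv a \<otimes> inv b \<in> ?H" if a: "a \<in> carrier B" and b: "b \<in> carrier B" for a b
  proof -
    let ?c = "a \<otimes> b \<otimes> inv a \<otimes> inv b"
    have c: "?c \<in> carrier B" using a b by simp
    have "?c \<otimes> (b \<otimes> a) = a \<otimes> b"
      using a b by (simp add: m_assoc inv_mult_group[symmetric])
    moreover have "brace_star B ?c w \<in> N" if eq: "?c \<otimes> (b \<otimes> a) = a \<otimes> b" and w: "w \<in> W" for w
    proof -
      have wc: "w \<in> carrier B" using w W by blast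
      \<comment> \<open>Expand \<open>(c(ba)) * w = (ab) * w\<close> by
        \<open>star_mult_left\<close>. The iterated products \<open>?n\<close>, \<open>?m\<close>,
        \<open>?k\<close> lie in \<open>N\<close> by \<open>NN\<close>, and the central terms
        \<open>?s\<close>, \<open>?t\<close> occur on both sides and cancel. This expresses
        \<open>c * w\<close> by elements of \<open>N\<close>.\<close>
      let ?n = "brace_star B ?c (brace_star B (b \<otimes> a) w)"
      let ?m = "brace_star B b (brace_star B a w)"
      let ?k = "brace_star B a (brace_star B b w)"
      let ?s = "brace_star B a w" and ?t = "brace_star B b w"
      note Z = star_in_center[OF central]
      note comm = center_add_commute[OF Z] center_add_left_commute[OF Z]
      have "?n \<oplus> (?m \<oplus> ?s \<oplus> ?t) \<oplus> brace_star B ?c w = ?k \<oplus> ?t \<oplus> ?s"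
        using star_mult_left[of ?c "b \<otimes> a" w] star_mult_left[of a b w] star_mult_left[of b a w] a b c wc eq
        by simp
      then have "(?n \<oplus> ?m \<oplus> brace_star B ?c w) \<oplus> (?s \<oplus> ?t) = ?k \<oplus> (?s \<oplus> ?t)"
        using a b c wc comm(1)[OF b wc, of "brace_star B ?c w"] comm(1)[OF b wc, of ?s]
          comm(2)[OF a wc, of "brace_star B ?c w" ?t]
        by (simp add: A.m_assoc)
      then have k: "?n \<oplus> ?m \<oplus> brace_star B ?c w = ?k"
        using a b c wc by simp
      have "brace_star B ?c w = \<ominus> ?m \<oplus> (\<ominus> ?n \<oplus> (?n \<oplus> ?m \<oplus> brace_star B ?c w))"
        using a b c wc by (simp add: brace_simps)
      then have "brace_star B ?c w = \<ominus> ?m \<oplus> (\<ominus> ?n \<oplus> ?k)"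
        unfolding k .
      then show ?thesis
        using NN[OF c _ w, of "b \<otimes> a"] NN[OF b a w] NN[OF a b w] a b
        by (simp add: left_ideal_add[OF N] left_ideal_minus[OF N])
    qed
    ultimately show ?thesis using c by blast
  qed
  then have "?H = carrier B"
    using carrier_eq_of_derived_set_subset[OF perfect sub] by auto
  then show ?thesis using assms by blast
qed

end

section \<open>Centralizers as ideals, and the star as a biadditive map\<close>

context two_sided_skew_brace
begin

text \<open>Lambda maps and multiplicative conjugations are additive automorphisms that preserve
  \<open>X\<close>, hence also its centralizer. Additive conjugates of star products need not be
  star products, so only \<open>- u + v\<close> with \<open>u\<close>, \<open>v\<close> in
  \<open>X\<close> is asked for; whatever commutes with \<open>u\<close> and \<open>v\<close>
  commutes with this too.\<close>

lemma ideal_centralizer: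
  assumes X: "X \<subseteq> carrier B"
    and lam: "\<And>y s. \<lbrakk>y \<in> carrier B; s \<in> X\<rbrakk> \<Longrightarrow> brace_lambda B y s \<in> X"
    and conj: "\<And>y s. \<lbrakk>y \<in> carrier B; s \<in> X\<rbrakk> \<Longrightarrow> y \<otimes> s \<otimes> inv y \<in> X"
    and add_conj: "\<And>y s. \<lbrakk>y \<in> carrier B; s \<in> X\<rbrakk> \<Longrightarrow> \<exists>u\<in>X. \<exists>v\<in>X. \<ominus> y \<oplus> s \<oplus> y = \<ominus> u \<oplus> v"
  shows "brace_ideal B {x \<in> carrier B. \<forall>s\<in>X. x \<oplus> s = s \<oplus> x}" (is "brace_ideal B ?C")
proof (rule brace_idealI)
  have C: "x \<oplus> s = s \<oplus> x" "x \<in> carrier B" if "x \<in> ?C" "s \<in> X" for x s using that by auto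
  have Xc: "s \<in> carrier B" if "s \<in> X" for s using that X by auto
  show "subgroup ?C (add_monoid B)"
  proof (rule A.subgroupI)
    show "?C \<noteq> {}" using Xc by (auto intro!: exI[of _ \<zero>])
    show "\<ominus> x \<in> ?C" if "x \<in> ?C" for x
      using that add_commute_minus[of _ x] Xc by simp
    show "x \<oplus> y \<in> ?C" if "x \<in> ?C" "y \<in> ?C" for x y
    proof -
      have "x \<oplus> y \<oplus> s = s \<oplus> (x \<oplus> y)" if s: "s \<in> X" for s
      proof -
        have "x \<oplus> y \<oplus> s = x \<oplus> (s \<oplus> y)"
          using C[OF \<open>x \<in> ?C\<close> s] C[OF \<open>y \<in> ?C\<close> s] Xc[OF s] by (simp add: A.m_assoc)
        also have "\<dots> = s \<oplus> x \<oplus> y"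
          using C[OF \<open>x \<in> ?C\<close> s] C[OF \<open>y \<in> ?C\<close> s] Xc[OF s] by (simp add: A.m_assoc[symmetric])
        finally show ?thesis
          using C[OF \<open>x \<in> ?C\<close> s] C[OF \<open>y \<in> ?C\<close> s] Xc[OF s] by (simp add: A.m_assoc)
      qed
      then show ?thesis using that by simp
    qed
  qed auto
  fix y x assume y: "y \<in> carrier B" and x: "x \<in> ?C"
  then have xc: "x \<in> carrier B" by simp
  have "y \<oplus> x \<ominus> y \<oplus> s = s \<oplus> (y \<oplus> x \<ominus> y)" if s: "s \<in> X" for s
  proof -
    obtain u v where uv: "u \<in> X" "v \<in> X" "\<ominus> y \<oplus> s \<oplus> y = \<ominus> u \<oplus> v"
      using add_conj[OF y s] by blast
    let ?t = "\<ominus> y \<oplus> s \<oplus> y"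
    have "x \<oplus> (\<ominus> u \<oplus> v) = \<ominus> u \<oplus> (x \<oplus> v)"
      using add_commute_minus[of x u] C(1)[OF x uv(1)] xc Xc uv(1,2) by (simp add: A.m_assoc[symmetric])
    then have "x \<oplus> ?t = ?t \<oplus> x"
      using uv Xc xc C(1)[OF x uv(2)] by (simp add: A.m_assoc)
    then have "y \<oplus> (x \<oplus> ?t) \<ominus> y = y \<oplus> (?t \<oplus> x) \<ominus> y" by simp
    then show ?thesis using y s Xc xc by (simp add: brace_simps)
  qed
  then show "y \<oplus> x \<ominus> y \<in> ?C" using y xc by (simp add: a_minus_def)
  have "brace_lambda B y x \<oplus> s = s \<oplus> brace_lambda B y x" if s: "s \<in> X" for s
  proof -
    let ?t = "brace_lambda B (inv y) s"
    have "?t \<in> X" using lam y s by simp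
    then have "brace_lambda B y (x \<oplus> ?t) = brace_lambda B y (?t \<oplus> x)" using C(1)[OF x] by simp
    then show ?thesis using y s Xc xc by (simp add: lambda_add lambda_closed lambda_inv_cancel)
  qed
  then show "brace_lambda B y x \<in> ?C" using y xc by (simp add: lambda_closed)
  have "y \<otimes> x \<otimes> inv y \<oplus> s = s \<oplus> y \<otimes> x \<otimes> inv y" if s: "s \<in> X" for s
  proof -
    let ?t = "inv y \<otimes> s \<otimes> y"
    have "?t \<in> X" using conj[of "inv y" s] y s by simp
    then have "y \<otimes> (x \<oplus> ?t) \<otimes> inv y = y \<otimes> (?t \<oplus> x) \<otimes> inv y" using C(1)[OF x] by simp
    moreover have "y \<otimes> ?t \<otimes> inv y = s"
      using y s Xc by (simp add: m_assoc) (simp add: m_assoc[symmetric])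
    ultimately show ?thesis using y s Xc xc by (simp add: conj_add)
  qed
  then show "y \<otimes> x \<otimes> inv y \<in> ?C" using y xc by simp
qed

lemma ideal_add_center: "brace_ideal B (group_center (add_monoid B))"
proof -
  have "brace_ideal B {x \<in> carrier B. \<forall>s\<in>carrier B. x \<oplus> s = s \<oplus> x}"
  proof (rule ideal_centralizer)
    show "\<exists>u\<in>carrier B. \<exists>v\<in>carrier B. \<ominus> y \<oplus> s \<oplus> y = \<ominus> u \<oplus> v"
      if "y \<in> carrier B" "s \<in> carrier B" for y s
      using that by (intro bexI[of _ \<zero>] bexI[of _ "\<ominus> y \<oplus> s \<oplus> y"]) auto
  qed (auto simp: lambda_closed)
  then show ?thesis by (simp add: group_center_def)
qed

lemma ideal_star_centralizer: "brace_ideal B (star_centralizer B)"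
proof -
  let ?X = "{brace_star B a b | a b. a \<in> carrier B \<and> b \<in> carrier B}"
  have "brace_ideal B {x \<in> carrier B. \<forall>s\<in>?X. x \<oplus> s = s \<oplus> x}"
  proof (rule ideal_centralizer)
    fix y s assume y: "y \<in> carrier B" and "s \<in> ?X"
    then obtain a b where ab: "a \<in> carrier B" "b \<in> carrier B" and s: "s = brace_star B a b" by blast
    show "brace_lambda B y s \<in> ?X"
      using y ab lambda_star[of a b y] lambda_closed[of y b] unfolding s by (blast intro: m_closed inv_closed)
    show "y \<otimes> s \<otimes> inv y \<in> ?X"
      using y ab conj_star[of y a b] unfolding s by (blast intro: m_closed inv_closed)
    \<comment> \<open>This is \<open>star_add_right'\<close> for \<open>a * (- y + b)\<close>,
      solved for the conjugate of \<open>a * b\<close>.\<close>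
    have "\<ominus> y \<oplus> s \<oplus> y = \<ominus> brace_star B a (\<ominus> y) \<oplus> brace_star B a (\<ominus> y \<oplus> b)"
      using y ab by (simp add: s star_add_right' brace_simps)
    then show "\<exists>u\<in>?X. \<exists>v\<in>?X. \<ominus> y \<oplus> s \<oplus> y = \<ominus> u \<oplus> v"
      using y ab by (blast intro: A.m_closed A.inv_closed)
  qed auto
  moreover have "{x \<in> carrier B. \<forall>s\<in>?X. x \<oplus> s = s \<oplus> x} = star_centralizer B"
    by (auto simp: star_centralizer_def)
  ultimately show ?thesis by simp
qed

lemma star_opposite_in_star_centralizer:
  assumes "a \<in> carrier B" "b \<in> carrier B"
  shows "brace_star (opposite B) a b \<in> star_centralizer B"
proof -
  have "brace_star (opposite B) a b \<in> carrier B"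
    using assms skew_brace.star_closed[OF skew_brace_opposite, of a b] by simp
  then show ?thesis
    using assms star_commutes_star_opposite by (simp add: star_centralizer_def)
qed

lemma star_central_iff: "star_central B \<longleftrightarrow> star_centralizer B = carrier B"
proof
  show "star_centralizer B = carrier B" if "star_central B"
    using that by (auto simp: star_central_def star_centralizer_def group_center_def)
  show "star_central B" if *: "star_centralizer B = carrier B"
  proof -
    have "x \<oplus> brace_star B a b = brace_star B a b \<oplus> x"
      if "x \<in> carrier B" "a \<in> carrier B" "b \<in> carrier B" for x a b
    proof -
      have "x \<in> star_centralizer B" using that * by simp
      then show ?thesis using that by (simp add: star_centralizer_def)
    qed
    then show ?thesis by (simp add: star_central_def group_center_def)
  qed
qed

text \<open>Right distributivity puts \<open>a * c\<close> between \<open>- b\<close> and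
  \<open>bc - c\<close>; being central, it can be moved to the front.\<close>

lemma star_add_left:
  assumes central: "star_central B" and abc: "a \<in> carrier B" "b \<in> carrier B" "c \<in> carrier B"
  shows "brace_star B (a \<oplus> b) c = brace_star B a c \<oplus> brace_star B b c"
proof -
  have "brace_star B (a \<oplus> b) c = \<ominus> b \<oplus> (brace_star B a c \<oplus> (b \<otimes> c \<ominus> c))"
    using abc by (simp add: brace_star_def brace_lambda_def right_distrib brace_simps)
  also have "\<dots> = brace_star B a c \<oplus> (\<ominus> b \<oplus> (b \<otimes> c \<ominus> c))"
    using abc center_add_left_commute[OF star_in_center[OF central]] by (simp add: a_minus_def)
  finally show ?thesis
    using abc by (simp add: brace_star_def brace_lambda_def brace_simps)
qed

lemma star_minus_left:
  assumes central: "star_central B" and ab: "a \<in> carrier B" "b \<in> carrier B"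
  shows "brace_star B (\<ominus> a) b = \<ominus> brace_star B a b"
proof -
  have "brace_star B (\<ominus> a) b \<oplus> brace_star B a b = brace_star B \<zero> b"
    using star_add_left[OF central, of "\<ominus> a" a b] ab by simp
  also have "\<dots> = \<zero>"
    using ab lambda_one[of b] by (simp add: brace_star_def a_minus_def zero_eq_one[symmetric])
  finally show ?thesis using ab by (intro A.inv_equality[symmetric]) auto
qed

text \<open>A version of Nakayama's lemma for the left ideal \<open>V\<close>: if a maximal proper left subideal \<open>N\<close>
  missed some \<open>brace_star B a x\<close>, then by maximality \<open>x = n \<oplus> brace_star B b x\<close> with \<open>n \<in> N\<close>, that is,
  \<open>n = brace_lambda B (\<ominus> b) x\<close>, and applying the inverse of \<open>brace_lambda B (\<ominus> b)\<close> gives \<open>x \<in> N\<close>.\<close>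
lemma nakayama:
  assumes central: "star_central B" and fin: "finite (carrier B)"
    and V: "left_brace_ideal B V" and VZ: "V \<subseteq> group_center (add_monoid B)" and V0: "V \<noteq> {\<zero>}"
  obtains N where "left_brace_ideal B N" "N \<subset> V"
    "\<And>a v. \<lbrakk>a \<in> carrier B; v \<in> V\<rbrakk> \<Longrightarrow> brace_star B a v \<in> N"
proof -
  let ?P = "{N. left_brace_ideal B N \<and> N \<subset> V}"
  have "?P \<subseteq> Pow (carrier B)" using left_ideal_closed by blast
  then have "finite ?P" by (rule finite_subset) (simp add: fin)
  moreover have "left_brace_ideal B {\<zero>}"
    by (rule left_idealI) auto
  then have "?P \<noteq> {}" using V0 left_ideal_zero[OF V] by blast
  ultimately obtain N where N: "N \<in> ?P" and max: "\<And>M. M \<in> ?P \<Longrightarrow> N \<subseteq> M \<Longrightarrow> N = M"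
    using finite_has_maximal[of ?P] by metis
  have NB: "left_brace_ideal B N" and NV: "N \<subset> V" using N by auto
  note Vc = left_ideal_closed[OF V] and Nc = left_ideal_closed[OF NB]
  have "brace_star B a x \<in> N" if a: "a \<in> carrier B" and x: "x \<in> V" for a x
  proof (rule ccontr)
    assume ax: "brace_star B a x \<notin> N"
    \<comment> \<open>\<open>M\<close> is \<open>N + B * x\<close>. It is a left ideal because the
      star is additive in its first argument and
      \<open>lambda_c (b * x) = (cb - c) * x\<close>.\<close>
    define M where "M = {n \<oplus> brace_star B b x | n b. n \<in> N \<and> b \<in> carrier B}"
    have xc: "x \<in> carrier B" using x Vc by blast
    have NZ: "n \<in> group_center (add_monoid B)" if "n \<in> N" for n using that NV VZ by blast
    have M: "left_brace_ideal B M"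
    proof (rule left_idealI)
      show "M \<subseteq> carrier B" using xc Nc by (auto simp: M_def)
      have "\<zero> = \<zero> \<oplus> brace_star B \<zero> x"
        using xc lambda_one[of x] by (simp add: brace_star_def a_minus_def zero_eq_one[symmetric])
      then show "\<zero> \<in> M" using left_ideal_zero[OF NB] A.one_closed unfolding M_def by blast
    next
      fix y z assume "y \<in> M" "z \<in> M"
      then obtain n b m c where y: "n \<in> N" "b \<in> carrier B" "y = n \<oplus> brace_star B b x"
        and z: "m \<in> N" "c \<in> carrier B" "z = m \<oplus> brace_star B c x" unfolding M_def by blast
      have "y \<oplus> z = (n \<oplus> m) \<oplus> brace_star B (b \<oplus> c) x"
        using y z xc Nc center_add_left_commute[OF NZ[OF z(1)], symmetric]
        by (simp add: star_add_left[OF central] A.m_assoc)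
      then show "y \<oplus> z \<in> M" using left_ideal_add[OF NB] y z unfolding M_def by blast
    next
      fix y assume "y \<in> M"
      then obtain n b where y: "n \<in> N" "b \<in> carrier B" "y = n \<oplus> brace_star B b x"
        unfolding M_def by blast
      have "\<ominus> y = \<ominus> n \<oplus> brace_star B (\<ominus> b) x"
        using y xc Nc center_add_commute[OF NZ, of "\<ominus> n"] left_ideal_minus[OF NB]
        by (simp add: star_minus_left[OF central] A.inv_mult_group)
      then show "\<ominus> y \<in> M" using left_ideal_minus[OF NB] y unfolding M_def by blast
    next
      fix c y assume c: "c \<in> carrier B" and "y \<in> M"
      then obtain n b where y: "n \<in> N" "b \<in> carrier B" "y = n \<oplus> brace_star B b x"
        unfolding M_def by blast
      have "brace_lambda B c (brace_star B b x) = brace_star B (c \<otimes> b) x \<ominus> brace_star B c x"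
        using c y xc by (simp add: brace_star_def lambda_mult[symmetric] lambda_add lambda_minus lambda_closed brace_simps)
      then have "brace_lambda B c y = brace_lambda B c n \<oplus> brace_star B (c \<otimes> b \<ominus> c) x"
        using c y xc Nc
        by (simp add: lambda_add star_add_left[OF central] star_minus_left[OF central] a_minus_def)
      moreover have "c \<otimes> b \<ominus> c \<in> carrier B" using c y by (simp add: a_minus_def)
      ultimately show "brace_lambda B c y \<in> M"
        using left_ideal_lambda[OF NB c y(1)] unfolding M_def by blast
    qed
    have "M \<subseteq> V"
      using left_ideal_add[OF V] left_ideal_star[OF V] x NV by (auto simp: M_def)
    moreover have "N \<subseteq> M"
    proof
      fix n assume n: "n \<in> N"
      have "n = n \<oplus> brace_star B \<zero> x"
        using n Nc xc lambda_one[of x] by (simp add: brace_star_def a_minus_def zero_eq_one[symmetric])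
      then show "n \<in> M" using n A.one_closed unfolding M_def by blast
    qed
    moreover have "brace_star B a x \<in> M"
      using a xc left_ideal_zero[OF NB] unfolding M_def
      by (intro CollectI exI[of _ \<zero>] exI[of _ a]) simp
    ultimately have "M = V" using max[of M] M ax by blast
    then obtain n b where n: "n \<in> N" and b: "b \<in> carrier B" and eq: "x = n \<oplus> brace_star B b x"
      using x unfolding M_def by blast
    have "n = n \<oplus> brace_star B b x \<ominus> brace_star B b x"
      using n b xc Nc by (simp add: brace_simps)
    then have "n = x \<ominus> brace_star B b x"
      unfolding eq[symmetric] .
    also have "\<dots> = brace_lambda B (\<ominus> b) x"
      using b xc center_add_commute[OF star_in_center[OF central], of "\<ominus> b" x x]
      by (simp add: lambda_eq_star_add star_minus_left[OF central] a_minus_def)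
    finally have "x \<in> N"
      using left_ideal_lambda[OF NB _ n, of "inv (\<ominus> b)"] b xc by (simp add: lambda_inv_cancel)
    then show False using ax left_ideal_star[OF NB a] by blast
  qed
  then show thesis using that NB NV by blast
qed

text \<open>Perfectness improves \<open>B * (B * W) \<subseteq> N\<close> to
  \<open>B * W \<subseteq> N\<close>. With \<open>W\<close> the additive center this yields
  \<open>V = {\<zero>}\<close>, so central elements have zero star products. As star products are
  central, \<open>B * (B * B)\<close> is then zero, and \<open>W = carrier B\<close>,
  \<open>N = {\<zero>}\<close> finishes the proof.\<close>

lemma star_trivial_if_mult_perfect:
  assumes central: "star_central B" and fin: "finite (carrier B)"
    and perfect: "derived B (carrier B) = carrier B"
    and "a \<in> carrier B" "b \<in> carrier B"
  shows "brace_star B a b = \<zero>"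
proof -
  let ?Z = "group_center (add_monoid B)"
  have Z: "left_brace_ideal B ?Z"
    unfolding left_brace_ideal_def
    by (intro conjI ballI ideal_add_subgroup ideal_lambda ideal_add_center)
  let ?P = "{V. left_brace_ideal B V \<and> V \<subseteq> ?Z \<and> (\<forall>a\<in>carrier B. \<forall>z\<in>?Z. brace_star B a z \<in> V)}"
  have ZB: "?Z \<subseteq> carrier B"
    using left_ideal_closed[OF Z] by (rule subsetI)
  have "?P \<subseteq> Pow (carrier B)"
    by (rule subsetI) (rule PowI, rule subset_trans[OF _ ZB], simp)
  then have "finite ?P" by (rule finite_subset) (simp add: fin)
  moreover have "?Z \<in> ?P" using Z left_ideal_star[OF Z] by simp
  then have "?P \<noteq> {}" by (intro notI) simp
  ultimately have "\<exists>V\<in>?P. \<forall>N\<in>?P. N \<subseteq> V \<longrightarrow> V = N"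
    by (rule finite_has_minimal)
  then obtain V where V: "V \<in> ?P" and min: "\<And>N. N \<in> ?P \<Longrightarrow> N \<subseteq> V \<Longrightarrow> V = N"
    by (elim bexE) simp
  \<comment> \<open>Otherwise Nakayama's lemma and perfectness make a proper left subideal of \<open>V\<close> a member of \<open>?P\<close>.\<close>
  have "V = {\<zero>}"
  proof (rule ccontr)
    assume "V \<noteq> {\<zero>}"
    then obtain N where N: "left_brace_ideal B N" "N \<subset> V"
      and NV: "\<And>a v. \<lbrakk>a \<in> carrier B; v \<in> V\<rbrakk> \<Longrightarrow> brace_star B a v \<in> N"
      using nakayama[OF central fin, of V] V by auto
    have "brace_star B a z \<in> N" if "a \<in> carrier B" "z \<in> ?Z" for a z
    proof (rule star_in_left_ideal_if_mult_perfect[OF central perfect N(1) _ _ that])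
      show "?Z \<subseteq> carrier B" by (rule ZB)
      show "brace_star B b (brace_star B c w) \<in> N"
        if "b \<in> carrier B" "c \<in> carrier B" "w \<in> ?Z" for b c w
        using NV that V by simp
    qed
    then have "N \<in> ?P" using N V by auto
    then have "V = N" using min N(2) by simp
    then show False using N(2) by simp
  qed
  then have zero: "brace_star B a (brace_star B b c) \<in> {\<zero>}"
    if "a \<in> carrier B" "b \<in> carrier B" "c \<in> carrier B" for a b c
    using that V star_in_center[OF central, of b c] by simp
  have "left_brace_ideal B {\<zero>}"
    by (rule left_idealI) auto
  then have "brace_star B a b \<in> {\<zero>}"
    by (rule star_in_left_ideal_if_mult_perfect[OF central perfect _ subset_refl zero]) (use assms in auto)
  then show ?thesis by simp
qed

end

section \<open>Perfectness and quasi-simplicity\<close>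

context skew_brace
begin

text \<open>Modulo \<open>I\<close> the two operations agree and the addition commutes, hence so
  does the multiplication; \<open>rcoset_eq\<close> turns the additive congruence
  \<open>ab = ba\<close> into a multiplicative one. The generator \<open>ab - (a + b)\<close> is the
  additive conjugate \<open>a + a * b - a\<close>.\<close>

lemma commutator_ideal_subset:
  assumes I: "brace_ideal B I"
    and add: "\<And>a b. \<lbrakk>a \<in> carrier B; b \<in> carrier B\<rbrakk> \<Longrightarrow> a \<oplus> b \<ominus> a \<ominus> b \<in> I"
    and star: "\<And>a b. \<lbrakk>a \<in> carrier B; b \<in> carrier B\<rbrakk> \<Longrightarrow> brace_star B a b \<in> I"
  shows "commutator_ideal B \<subseteq> I"
proof -
  have mult: "a \<otimes> b \<ominus> (a \<oplus> b) \<in> I" if "a \<in> carrier B" "b \<in> carrier B" for a b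
    using ideal_add_conj[OF I that(1) star[OF that]] that by (simp add: mult_eq_star brace_simps)
  have "a \<otimes> b \<otimes> inv a \<otimes> inv b \<in> I" if a: "a \<in> carrier B" and b: "b \<in> carrier B" for a b
  proof -
    \<comment> \<open>\<open>?i\<close> is \<open>ab - ba\<close>, telescoped through
      \<open>a + b\<close> and \<open>b + a\<close>.\<close>
    let ?i = "(a \<otimes> b \<ominus> (a \<oplus> b)) \<oplus> (a \<oplus> b \<ominus> a \<ominus> b) \<oplus> \<ominus> (b \<otimes> a \<ominus> (b \<oplus> a))"
    have "?i \<in> I"
      using a b by (intro ideal_add[OF I] ideal_minus[OF I] mult add)
    moreover have "?i \<oplus> b \<otimes> a = a \<otimes> b"
      using a b by (simp add: brace_simps)
    ultimately have "a \<otimes> b \<in> I +> b \<otimes> a"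
      by (force simp: a_r_coset_def r_coset_def)
    then have "a \<otimes> b \<in> I #> b \<otimes> a"
      using rcoset_eq[OF I] a b by simp
    then obtain k where "k \<in> I" "a \<otimes> b = k \<otimes> (b \<otimes> a)" by (auto simp: r_coset_def)
    then show ?thesis
      using a b ideal_closed[OF I] by (simp add: m_assoc inv_mult_group[symmetric])
  qed
  then have "derived_set (add_monoid B) (carrier B) \<union> derived_set B (carrier B) \<union>
      {a \<otimes> b \<ominus> (a \<oplus> b) | a b. a \<in> carrier B \<and> b \<in> carrier B} \<subseteq> I"
    using add mult by (auto simp: a_minus_def a_inv_def)
  then show ?thesis
    using I unfolding commutator_ideal_def brace_ideal_generated_def by blast
qed

text \<open>An ideal with the generators of the opposite contains all additive commutators and star
  products of \<open>B\<close>. This inclusion carries perfectness from \<open>B\<close> to its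
  opposite.\<close>

lemma commutator_ideal_opposite:
  "commutator_ideal B \<subseteq> commutator_ideal (opposite B)"
proof -
  have *: "commutator_ideal B \<subseteq> I" if I': "brace_ideal (opposite B) I"
    and gen: "derived_set (add_monoid (opposite B)) (carrier (opposite B)) \<union>
      derived_set (opposite B) (carrier (opposite B)) \<union>
      {a \<otimes>\<^bsub>opposite B\<^esub> b \<ominus>\<^bsub>opposite B\<^esub> (a \<oplus>\<^bsub>opposite B\<^esub> b) | a b.
        a \<in> carrier (opposite B) \<and> b \<in> carrier (opposite B)} \<subseteq> I" for I
  proof (rule commutator_ideal_subset)
    show I: "brace_ideal B I"
      using skew_brace.ideal_opposite[OF skew_brace_opposite I'] by simp
    have add: "\<ominus> b \<oplus> (\<ominus> a \<oplus> (b \<oplus> a)) \<in> I" if ab: "a \<in> carrier B" "b \<in> carrier B" for a b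
    proof -
      have "a \<oplus>\<^bsub>opposite B\<^esub> b \<oplus>\<^bsub>opposite B\<^esub> \<ominus>\<^bsub>opposite B\<^esub> a \<oplus>\<^bsub>opposite B\<^esub> \<ominus>\<^bsub>opposite B\<^esub> b
          \<in> derived_set (add_monoid (opposite B)) (carrier (opposite B))"
        using ab unfolding a_inv_def by auto
      then show ?thesis using gen by auto
    qed
    show "a \<oplus> b \<ominus> a \<ominus> b \<in> I" if "a \<in> carrier B" "b \<in> carrier B" for a b
      using add[of "\<ominus> b" "\<ominus> a"] that by (simp add: brace_simps)
    show "brace_star B a b \<in> I" if ab: "a \<in> carrier B" "b \<in> carrier B" for a b
    proof -
      have "a \<otimes>\<^bsub>opposite B\<^esub> b \<ominus>\<^bsub>opposite B\<^esub> (a \<oplus>\<^bsub>opposite B\<^esub> b) \<in> I"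
        by (rule subsetD[OF gen], rule UnI2, rule CollectI, rule exI[of _ a], rule exI[of _ b])
          (simp add: ab)
      then have "b \<oplus> (\<ominus> (b \<oplus> a) \<oplus> a \<otimes> b) \<ominus> b \<in> I"
        using ideal_add_conj[OF I ab(2)] by simp
      \<comment> \<open>The additive commutator \<open>- a + b + a - b\<close> is placed in front of
        \<open>b - a - b + ab - b\<close>; the sum collapses to \<open>- a + ab - b\<close>, which
        is \<open>a * b\<close>.\<close>
      then have "\<ominus> a \<oplus> (\<ominus> (\<ominus> b) \<oplus> (a \<oplus> \<ominus> b)) \<oplus> (b \<oplus> (\<ominus> (b \<oplus> a) \<oplus> a \<otimes> b) \<ominus> b) \<in> I"
        using ideal_add[OF I add[of "\<ominus> b" a]] ab by simp
      then show ?thesis using ab by (simp add: brace_star_def brace_lambda_def brace_simps)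
    qed
  qed
  show ?thesis
    unfolding commutator_ideal_def[of "opposite B"] brace_ideal_generated_def
    by (rule Inter_greatest, elim CollectE conjE, rule *)
qed

text \<open>The opposite lambda map of \<open>z\<close> is the original one followed by additive
  conjugation with the central element \<open>z\<close>.\<close>

lemma brace_center_opposite: "brace_center B \<subseteq> brace_center (opposite B)"
proof
  fix z assume z: "z \<in> brace_center B"
  then have zc: "z \<in> group_center (add_monoid B)" "z \<in> group_center B"
    and lam: "brace_lambda B z a = a" if "a \<in> carrier B" for a
    using that by (auto simp: brace_center_def)
  have "brace_lambda (opposite B) z a = a" if a: "a \<in> carrier B" for a
  proof -
    have zB: "z \<in> carrier B" using zc(1)[OF a] by (rule center_closed)
    have "brace_lambda (opposite B) z a = (z \<oplus> brace_lambda B z a) \<ominus> z"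
      using a zB by (simp add: brace_lambda_def brace_simps)
    also have "\<dots> = a"
      using a zB center_add_commute[OF zc(1)[OF a] a] by (simp add: lam brace_simps)
    finally show ?thesis .
  qed
  moreover have "z \<in> group_center (add_monoid (opposite B))" "z \<in> group_center (opposite B)"
    using z unfolding group_center_add_opposite group_center_opposite brace_center_def by auto
  ultimately show "z \<in> brace_center (opposite B)"
    unfolding brace_center_def by simp
qed

section \<open>Ideals of the quotient by the center\<close>

lemma ideal_image:
  assumes I: "brace_ideal B I" and C: "skew_brace C"
    and add: "h \<in> hom (add_monoid B) (add_monoid C)" and mult: "h \<in> hom B C"
    and surj: "h ` carrier B = carrier C"
  shows "brace_ideal C (h ` I)"
proof -
  interpret C: skew_brace C by (rule C)
  have gh: "group_hom (add_monoid B) (add_monoid C) h"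
    using add add_group C.add_group by (simp add: group_hom_def group_hom_axioms_def)
  have gm: "group_hom B C h"
    using mult by unfold_locales
  have "h ` I \<lhd> add_monoid C"
    using I surj by (intro normal.surj_hom_normal_subgroup[OF _ gh]) (simp_all add: brace_ideal_def)
  moreover have "h ` I \<lhd> C"
    using I surj by (intro normal.surj_hom_normal_subgroup[OF _ gm]) (simp_all add: brace_ideal_def)
  moreover have "h (\<ominus> b) = \<ominus>\<^bsub>C\<^esub> h b" if "b \<in> carrier B" for b
    using group_hom.hom_inv[OF gh, of b] that by (simp add: a_inv_def)
  then have lam: "brace_lambda C (h b) (h i) = h (brace_lambda B b i)"
    if "b \<in> carrier B" "i \<in> carrier B" for b i
    using that hom_mult[OF add] hom_mult[OF mult] by (simp add: brace_lambda_def)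
  have "brace_lambda C c ` h ` I \<subseteq> h ` I" if "c \<in> carrier C" for c
  proof -
    have "c \<in> h ` carrier B" using that surj by simp
    then obtain b where b: "b \<in> carrier B" "c = h b" by (elim imageE)
    show ?thesis
      using ideal_lambda[OF I b(1)] ideal_closed[OF I] by (auto simp: b(2) lam[OF b(1)])
  qed
  ultimately show ?thesis by (simp add: brace_ideal_def)
qed

lemma
  assumes I: "brace_ideal B I"
  shows coset_hom_add: "(\<lambda>a. I +> a) \<in> hom (add_monoid B) (add_monoid (B Quot I))"
    and coset_hom_mult: "(\<lambda>a. I +> a) \<in> hom B (B Quot I)"
    and coset_surj: "(\<lambda>a. I +> a) ` carrier B = carrier (B Quot I)"
proof -
  interpret N: normal I B using I by (simp add: brace_ideal_def)
  have add_normal: "I \<lhd> add_monoid B" using I by (simp add: brace_ideal_def)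
  show surj: "(\<lambda>a. I +> a) ` carrier B = carrier (B Quot I)"
    by (auto simp: FactRing_def A_RCOSETS_def RCOSETS_def a_r_coset_def)
  show "(\<lambda>a. I +> a) \<in> hom (add_monoid B) (add_monoid (B Quot I))"
  proof (rule homI)
    show "I +> x \<in> carrier (add_monoid (B Quot I))" if "x \<in> carrier (add_monoid B)" for x
      using that unfolding surj[symmetric] partial_object.simps by blast
    show "I +> x \<otimes>\<^bsub>add_monoid B\<^esub> y = (I +> x) \<otimes>\<^bsub>add_monoid (B Quot I)\<^esub> (I +> y)"
      if "x \<in> carrier (add_monoid B)" "y \<in> carrier (add_monoid B)" for x y
      using normal.rcos_sum[OF add_normal that] by (simp add: FactRing_def set_add_def a_r_coset_def)
  qed
  have "(I +> a) \<otimes>\<^bsub>B Quot I\<^esub> (I +> b) = I +> a \<otimes> b"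
    if ab: "a \<in> carrier B" "b \<in> carrier B" for a b
  proof -
    \<comment> \<open>\<open>rcoset_mult\<close> is a union over all representatives, so every
      choice must give the same coset. Multiplicative cosets have this property, and
      \<open>rcoset_eq\<close> identifies them with the additive ones.\<close>
    have "I +> x \<otimes> y = I +> a \<otimes> b" if "x \<in> I +> a" "y \<in> I +> b" for x y
    proof -
      have "x \<otimes> y \<in> I #> a \<otimes> b"
        using that ab N.rcos_sum[of a b] unfolding rcoset_eq[OF I ab(1)] rcoset_eq[OF I ab(2)] set_mult_def
        by blast
      then show ?thesis
        using repr_independence[OF _ _ N.is_subgroup, of "x \<otimes> y" "a \<otimes> b"] r_coset_subset_G[OF N.subset, of "a \<otimes> b"] ab
        by (simp add: rcoset_eq[OF I] subset_iff)
    qed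
    moreover have "a \<in> I +> a" "b \<in> I +> b"
      using ab rcos_self[OF _ N.is_subgroup] by (simp_all add: rcoset_eq[OF I])
    ultimately have "(\<Union>x\<in>I +> a. \<Union>y\<in>I +> b. I +> x \<otimes> y) = I +> a \<otimes> b" by blast
    then show ?thesis
      by (simp add: FactRing_def rcoset_mult_def)
  qed
  moreover have "I +> a \<in> carrier (B Quot I)" if "a \<in> carrier B" for a
    using that unfolding surj[symmetric] by blast
  ultimately show "(\<lambda>a. I +> a) \<in> hom B (B Quot I)"
    by (intro homI) simp_all
qed

text \<open>The image of \<open>I\<close> in the simple quotient is zero, so that \<open>I\<close>
  is central, or everything. In the latter case each element is a central one plus an element of
  \<open>I\<close>; the central summands drop out of additive commutators, and star products land in
  \<open>I\<close>, so perfectness gives \<open>I = carrier B\<close>.\<close>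

lemma central_or_full_ideal:
  assumes simple: "simple_skew_brace (B Quot brace_center B)"
    and perfect: "carrier B \<subseteq> commutator_ideal B"
    and I: "brace_ideal B I"
  shows "I = carrier B \<or> I \<subseteq> brace_center B"
proof -
  let ?Z = "brace_center B"
  note Z = brace_ideal_center
  have sub: "subgroup ?Z (add_monoid B)" by (rule ideal_add_subgroup[OF Z])
  have "brace_ideal (B Quot ?Z) ((\<lambda>a. ?Z +> a) ` I)"
    by (rule ideal_image[OF I skew_brace_Quot[OF Z] coset_hom_add[OF Z] coset_hom_mult[OF Z] coset_surj[OF Z]])
  then consider "(\<lambda>a. ?Z +> a) ` I = {?Z}" | "(\<lambda>a. ?Z +> a) ` I = carrier (B Quot ?Z)"
    using simple_skew_brace.ideal_cases[OF simple] by (auto simp: FactRing_def)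
  then show ?thesis
  proof cases
    case 1
    have "i \<in> ?Z" if "i \<in> I" for i
      using A.coset_join1[of ?Z i] 1 that ideal_closed[OF I] sub by auto
    then show ?thesis by blast
  next
    case 2
    have decomp: "\<exists>z\<in>?Z. \<exists>i\<in>I. a = z \<oplus> i" if a: "a \<in> carrier B" for a
    proof -
      have "?Z +> a \<in> (\<lambda>a. ?Z +> a) ` I"
        unfolding 2 coset_surj[OF Z, symmetric] using a by blast
      then obtain i where "i \<in> I" "?Z +> a = ?Z +> i" by blast
      moreover have "a \<in> ?Z +> a" using A.rcos_self[OF a sub] by simp
      ultimately show ?thesis by (auto simp: a_r_coset_def r_coset_def)
    qed
    have "commutator_ideal B \<subseteq> I"
    proof (rule commutator_ideal_subset[OF I])
      fix a b assume a: "a \<in> carrier B" and b: "b \<in> carrier B"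
      obtain z i where z: "z \<in> ?Z" and i: "i \<in> I" and a_eq: "a = z \<oplus> i" using decomp[OF a] by blast
      obtain w j where w: "w \<in> ?Z" and j: "j \<in> I" and b_eq: "b = w \<oplus> j" using decomp[OF b] by blast
      have c: "i \<in> carrier B" "j \<in> carrier B" "z \<in> carrier B" "w \<in> carrier B"
        using ideal_closed[OF I] ideal_closed[OF Z] i j z w by auto
      have "z \<in> group_center (add_monoid B)" and wZ: "w \<in> group_center (add_monoid B)"
        using z w by (auto simp: brace_center_def)
      note comm = center_add_left_commute[OF this(1)] center_add_left_commute[OF wZ]
      have "a \<oplus> b \<ominus> a \<ominus> b = z \<oplus> (i \<oplus> (w \<oplus> (j \<oplus> (\<ominus> i \<oplus> (\<ominus> z \<oplus> (\<ominus> j \<oplus> \<ominus> w))))))"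
        using c by (simp add: a_eq b_eq brace_simps)
      also have "\<dots> = i \<oplus> j \<ominus> i \<ominus> j"
        using c comm(1)[of i] comm(1)[of j] comm(1)[of "\<ominus> i"] comm(2)[of j] comm(2)[of "\<ominus> i"]
          comm(2)[of "\<ominus> z"] comm(2)[of "\<ominus> j"]
        by (simp add: brace_simps)
      finally show "a \<oplus> b \<ominus> a \<ominus> b \<in> I"
        using i j by (simp add: a_minus_def ideal_add[OF I] ideal_minus[OF I])
      \<comment> \<open>A central second factor gives a zero star product, so
        \<open>a * (w + j)\<close> reduces to the conjugate \<open>w + a * j - w\<close>.\<close>
      have "a \<otimes> w = w \<otimes> a" using w a by (auto simp: brace_center_def group_center_def)
      also have "\<dots> = w \<oplus> a" using mult_eq_add_lambda[of w a] w a c by (simp add: brace_center_def)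
      also have "\<dots> = a \<oplus> w" using center_add_commute[OF wZ a] .
      finally have "brace_star B a w = \<zero>" using a c by (simp add: brace_star_def brace_lambda_def brace_simps)
      moreover have "brace_star B a j \<in> I"
        using ideal_lambda[OF I a j] ideal_minus[OF I j] ideal_add[OF I] by (simp add: brace_star_def a_minus_def)
      ultimately show "brace_star B a b \<in> I"
        using a c ideal_add_conj[OF I c(4)] by (simp add: b_eq star_add_right')
    qed
    then show ?thesis using perfect ideal_closed[OF I] by blast
  qed
qed

lemma derived_opposite:
  assumes "derived B (carrier B) = carrier B"
  shows "derived (opposite B) (carrier B) = carrier B"
proof -
  interpret O: skew_brace "opposite B" by (rule skew_brace_opposite)
  have *: "derived_set (opposite B) (carrier B) = derived_set B (carrier B)" by simp
  have "subgroup (derived (opposite B) (carrier B)) (opposite B)"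
    unfolding derived_def by (rule O.generate_is_subgroup) auto
  then have "subgroup (derived (opposite B) (carrier B)) B" by simp
  moreover have "derived_set B (carrier B) \<subseteq> derived (opposite B) (carrier B)"
    unfolding derived_def * by (auto intro: generate.incl)
  ultimately show ?thesis
    using carrier_eq_of_derived_set_subset[OF assms] by blast
qed

lemma derived_add_opposite:
  assumes "derived (add_monoid B) (carrier B) = carrier B"
  shows "derived (add_monoid (opposite B)) (carrier B) = carrier B"
proof -
  interpret O: group "add_monoid (opposite B)"
    by (rule skew_brace.add_group[OF skew_brace_opposite])
  let ?D = "derived (add_monoid (opposite B)) (carrier B)"
  have inv: "inv\<^bsub>add_monoid (opposite B)\<^esub> x = \<ominus> x" for x
    using opposite_simps(7)[of B] by (simp add: a_inv_def)
  have "subgroup ?D (add_monoid (opposite B))"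
    unfolding derived_def using O.derived_set_in_carrier[of "carrier B"]
    by (intro O.generate_is_subgroup) simp
  then have sub: "subgroup ?D (add_monoid B)"
    using subgroup_add_opposite by blast
  have "derived_set (add_monoid B) (carrier B) \<subseteq> ?D"
  proof
    fix x assume "x \<in> derived_set (add_monoid B) (carrier B)"
    then obtain a b where ab: "a \<in> carrier B" "b \<in> carrier B"
      and x: "x = a \<oplus> b \<oplus> \<ominus> a \<oplus> \<ominus> b" by (auto simp: a_inv_def)
    \<comment> \<open>The commutator of \<open>a\<close> and \<open>b\<close> is that of
      \<open>- b\<close> and \<open>- a\<close> for the reversed addition.\<close>
    have "x \<in> derived_set (add_monoid (opposite B)) (carrier B)"
      by (rule UN_I[of "\<ominus> b"], simp add: ab, rule UN_I[of "\<ominus> a"], simp add: ab)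
        (simp add: x ab inv[simplified] A.m_assoc)
    then show "x \<in> ?D"
      unfolding derived_def by (rule generate.incl)
  qed
  then show ?thesis
    using A.carrier_eq_of_derived_set_subset[of ?D] assms sub by (simp add: a_inv_def)
qed

lemma trivial_opposite:
  "trivial_skew_brace (opposite B) \<Longrightarrow> almost_trivial_skew_brace B"
  using skew_brace_axioms by (simp add: trivial_skew_brace_def almost_trivial_skew_brace_def)

text \<open>Normality moves \<open>s\<close> to the left end, and there additive and multiplicative
  cosets of \<open>I\<close> coincide. Applied to \<open>ab = a + a * b + b\<close>, this compares
  \<open>ab\<close> with \<open>a + b\<close> multiplicatively.\<close>

lemma ideal_mult_eq:
  assumes I: "brace_ideal B I" and "a \<in> carrier B" "s \<in> I" "b \<in> carrier B"
  shows "\<exists>k\<in>I. a \<oplus> s \<oplus> b = k \<otimes> (a \<oplus> b)"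
proof -
  have "a \<oplus> s \<oplus> b = (a \<oplus> s \<ominus> a) \<oplus> (a \<oplus> b)"
    using assms ideal_closed[OF I] by (simp add: brace_simps)
  moreover have "a \<oplus> s \<ominus> a \<in> I" using ideal_add_conj[OF I] assms by simp
  ultimately have "a \<oplus> s \<oplus> b \<in> I +> (a \<oplus> b)" by (auto simp: a_r_coset_def r_coset_def)
  then show ?thesis using rcoset_eq[OF I] assms by (auto simp: r_coset_def)
qed

end

section \<open>Normal subgroups of quasi-simple groups\<close>

lemma group_centerD:
  fixes G (structure)
  assumes "z \<in> group_center G" "x \<in> carrier G"
  shows "z \<otimes> x = x \<otimes> z"
  using assms by (simp add: group_center_def)

lemma group_center_normal:
  fixes G (structure)
  assumes "group G"
  shows "group_center G \<lhd> G"
proof -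
  interpret group G by (rule assms)
  have comm: "z \<otimes> x = x \<otimes> z" and closed: "z \<in> carrier G"
    if "z \<in> group_center G" "x \<in> carrier G" for z x
    using that by (simp_all add: group_center_def)
  have fixed: "x \<otimes> z \<otimes> inv x = z" if "z \<in> group_center G" "x \<in> carrier G" for z x
    using that closed[OF that] by (simp add: comm[OF that, symmetric] m_assoc)
  have "subgroup (group_center G) G"
  proof (rule subgroupI)
    have "\<one> \<in> group_center G" by (simp add: group_center_def)
    then show "group_center G \<noteq> {}" by blast
    show sub: "group_center G \<subseteq> carrier G" by (auto simp: group_center_def)
    fix a assume a: "a \<in> group_center G"
    then have ac: "a \<in> carrier G" using sub by blast
    have "inv a \<otimes> x = x \<otimes> inv a" if x: "x \<in> carrier G" for x
      using arg_cong[OF comm[OF a, of "inv x"], of "m_inv G"] x ac by (simp add: inv_mult_group)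
    then show "inv a \<in> group_center G" using ac by (simp add: group_center_def)
    fix b assume b: "b \<in> group_center G"
    then have bc: "b \<in> carrier G" using sub by blast
    have "a \<otimes> b \<otimes> x = x \<otimes> (a \<otimes> b)" if x: "x \<in> carrier G" for x
    proof -
      have "a \<otimes> b \<otimes> x = a \<otimes> x \<otimes> b" using x ac bc comm[OF b x] by (simp add: m_assoc)
      then show ?thesis using x ac bc comm[OF a x] by (simp add: m_assoc)
    qed
    then show "a \<otimes> b \<in> group_center G" using ac bc by (simp add: group_center_def)
  qed
  then show ?thesis by (simp add: normal_inv_iff fixed)
qed

text \<open>If \<open>N\<close> maps onto the quotient by the center, each \<open>a\<close> is
  \<open>zn\<close> with \<open>z\<close> central and \<open>n\<close> in \<open>N\<close>. Then the
  commutator of \<open>a\<close> and \<open>b\<close> equals \<open>n (b (inv n) (inv b))\<close>,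
  which lies in \<open>N\<close>, and perfectness applies.\<close>

lemma quasi_simple_group_normal:
  fixes G (structure)
  assumes qs: "quasi_simple_group G" and N: "N \<lhd> G"
  shows "N = carrier G \<or> N \<subseteq> group_center G"
proof -
  interpret group G using qs by (simp add: quasi_simple_group_def)
  interpret N: normal N G by (rule N)
  let ?Z = "group_center G"
  interpret Z: normal ?Z G by (rule group_center_normal) (rule is_group)
  interpret Q: simple_group "G Mod ?Z" using qs by (simp add: quasi_simple_group_def)
  have "group_hom G (G Mod ?Z) (\<lambda>a. ?Z #> a)"
    using Z.r_coset_hom_Mod by unfold_locales
  then have img: "(\<lambda>a. ?Z #> a) ` N \<lhd> G Mod ?Z"
    by (rule N.surj_hom_normal_subgroup) (simp add: carrier_FactGroup)
  consider "(\<lambda>a. ?Z #> a) ` N = {?Z}" | "(\<lambda>a. ?Z #> a) ` N = carrier (G Mod ?Z)"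
    using Q.no_real_normal_subgroup[OF img] unfolding one_FactGroup by (elim disjE)
  then show ?thesis
  proof cases
    case 1
    have "n \<in> ?Z" if "n \<in> N" for n
      using coset_join1[of ?Z n] 1 that N.mem_carrier Z.is_subgroup by auto
    then show ?thesis by blast
  next
    case 2
    have decomp: "\<exists>z\<in>?Z. \<exists>n\<in>N. a = z \<otimes> n" if a: "a \<in> carrier G" for a
    proof -
      have "?Z #> a \<in> (\<lambda>a. ?Z #> a) ` N"
        unfolding 2 carrier_FactGroup using a by blast
      then obtain n where "n \<in> N" "?Z #> a = ?Z #> n" by blast
      then show ?thesis using rcos_self[OF a Z.is_subgroup] by (auto simp: r_coset_def)
    qed
    have "a \<otimes> b \<otimes> inv a \<otimes> inv b \<in> N" if a: "a \<in> carrier G" and b: "b \<in> carrier G" for a b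
    proof -
      obtain z n where z: "z \<in> ?Z" and n: "n \<in> N" and a_eq: "a = z \<otimes> n" using decomp[OF a] by blast
      have c: "n \<in> carrier G" "z \<in> carrier G"
        using N.mem_carrier[OF n] Z.mem_carrier[OF z] .
      let ?w = "n \<otimes> b \<otimes> inv n"
      have zw: "z \<otimes> ?w = ?w \<otimes> z"
        by (rule group_centerD[OF z]) (simp add: b c)
      have "a \<otimes> b \<otimes> inv a \<otimes> inv b = z \<otimes> ?w \<otimes> inv z \<otimes> inv b"
        using b c by (simp add: a_eq inv_mult_group m_assoc)
      also have "z \<otimes> ?w \<otimes> inv z = ?w"
        unfolding zw using b c by (simp add: m_assoc)
      also have "?w \<otimes> inv b = n \<otimes> (b \<otimes> inv n \<otimes> inv b)"
        using b c by (simp add: m_assoc)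
      finally have "a \<otimes> b \<otimes> inv a \<otimes> inv b = n \<otimes> (b \<otimes> inv n \<otimes> inv b)" .
      then show ?thesis
        using N.inv_op_closed2[OF b, of "inv n"] n by simp
    qed
    then have "derived_set G (carrier G) \<subseteq> N" by auto
    then have "N = carrier G"
      using carrier_eq_of_derived_set_subset[OF _ N.is_subgroup] qs by (simp add: quasi_simple_group_def)
    then show ?thesis by simp
  qed
qed

section \<open>The three kinds of quasi-simplicity\<close>

context two_sided_skew_brace
begin

text \<open>The additive center is everything or contained in the brace center. If it is everything
  and \<open>B\<close> is non-zero, Nakayama's lemma yields a proper ideal containing all star
  products, against perfectness. In the other case star products lie in the brace center, so the
  star annihilator is an ideal containing them and the additive commutators; by perfectness it is
  all of \<open>B\<close>.\<close>

lemma star_trivial_if_quasi_simple: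
  assumes central: "star_central B" and fin: "finite (carrier B)"
    and perfect: "carrier B \<subseteq> commutator_ideal B"
    and cases: "\<And>I. brace_ideal B I \<Longrightarrow> I = carrier B \<or> I \<subseteq> brace_center B"
    and "a \<in> carrier B" "b \<in> carrier B"
  shows "brace_star B a b = \<zero>"
proof -
  let ?Z = "group_center (add_monoid B)"
  consider "?Z = carrier B" "carrier B = {\<zero>}" | "?Z = carrier B" "carrier B \<noteq> {\<zero>}" | "?Z \<subseteq> brace_center B"
    using cases[OF ideal_add_center] by blast
  then show ?thesis
  proof cases
    case 1
    then show ?thesis using assms star_closed by blast
  next
    case 2
    have comm: "x \<oplus> y = y \<oplus> x" if "x \<in> carrier B" "y \<in> carrier B" for x y
      using that 2(1) center_add_commute by blast
    have "left_brace_ideal B (carrier B)"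
      by (rule left_idealI) (auto simp: lambda_closed)
    then obtain N where N: "left_brace_ideal B N" "N \<subset> carrier B"
      and star: "\<And>a v. \<lbrakk>a \<in> carrier B; v \<in> carrier B\<rbrakk> \<Longrightarrow> brace_star B a v \<in> N"
      using nakayama[OF central fin, of "carrier B"] 2 by blast
    have "brace_ideal B N"
    proof (rule brace_idealI)
      fix x i assume x: "x \<in> carrier B" and i: "i \<in> N"
      have ic: "i \<in> carrier B" using i N by blast
      show "x \<oplus> i \<ominus> x \<in> N" using x i ic comm[of x i] by (simp add: brace_simps)
      show "brace_lambda B x i \<in> N" by (rule left_ideal_lambda[OF N(1) x i])
      \<comment> \<open>Expanding \<open>nx = xi\<close> and cancelling \<open>x\<close> in the
        abelian additive group gives \<open>n = x * i + i - n * x\<close>, where both star products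
        lie in \<open>N\<close>.\<close>
      let ?n = "x \<otimes> i \<otimes> inv x"
      have n: "?n \<in> carrier B" using x ic by simp
      have "?n \<oplus> brace_star B ?n x \<oplus> x = x \<oplus> brace_star B x i \<oplus> i"
        using mult_eq_star[OF n x] mult_eq_star[OF x ic] x ic by (simp add: m_assoc)
      then have "?n \<oplus> brace_star B ?n x \<oplus> x = brace_star B x i \<oplus> i \<oplus> x"
        using comm[of x "brace_star B x i \<oplus> i"] x ic by (simp add: A.m_assoc)
      then have "?n \<oplus> brace_star B ?n x = brace_star B x i \<oplus> i"
        using x n ic by simp
      then have "?n = brace_star B x i \<oplus> i \<ominus> brace_star B ?n x"
        using x n ic A.inv_solve_right[of ?n "brace_star B x i \<oplus> i" "brace_star B ?n x"] by (simp add: a_minus_def)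
      then show "?n \<in> N"
        using star[OF x ic] star[OF n x] i left_ideal_add[OF N(1)] left_ideal_minus[OF N(1)]
        by (metis a_minus_def)
    qed (rule left_ideal_subgroup[OF N(1)])
    then have "commutator_ideal B \<subseteq> N"
    proof (rule commutator_ideal_subset)
      show "x \<oplus> y \<ominus> x \<ominus> y \<in> N" if "x \<in> carrier B" "y \<in> carrier B" for x y
        using that comm[of x y] left_ideal_zero[OF N(1)] by (simp add: brace_simps)
    qed (rule star)
    then show ?thesis using perfect N(2) by blast
  next
    case 3
    let ?K = "star_annihilator B"
    have K: "d \<in> carrier B" "brace_star B x d = \<zero>" if "d \<in> ?K" "x \<in> carrier B" for d x
      using that by (auto simp: star_annihilator_def)
    have KI: "d \<in> ?K" if "d \<in> carrier B" "\<And>x. x \<in> carrier B \<Longrightarrow> brace_star B x d = \<zero>" for d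
      using that by (simp add: star_annihilator_def)
    have "brace_ideal B ?K"
    proof (rule brace_idealI)
      fix x d assume x: "x \<in> carrier B" and d: "d \<in> ?K"
      have dc: "d \<in> carrier B" using K(1)[OF d x] .
      show "x \<oplus> d \<ominus> x \<in> ?K"
        using x dc K(2)[OF d]
        by (intro KI) (simp_all add: a_minus_def star_add_right[OF central] star_minus_right[OF central])
      show "brace_lambda B x d \<in> ?K"
        using lambda_eq_star_add[OF x dc] K(2)[OF d x] dc d by simp
      show "x \<otimes> d \<otimes> inv x \<in> ?K"
      proof (rule KI)
        fix y assume y: "y \<in> carrier B"
        have "brace_star B y (x \<otimes> d \<otimes> inv x) = x \<otimes> brace_star B (inv x \<otimes> y \<otimes> x) d \<otimes> inv x"
        proof -
          have "x \<otimes> (inv x \<otimes> y \<otimes> x) \<otimes> inv x = y"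
            using x y by (simp add: m_assoc) (simp add: m_assoc[symmetric])
          then show ?thesis using conj_star[of x "inv x \<otimes> y \<otimes> x" d] x y dc by simp
        qed
        then show "brace_star B y (x \<otimes> d \<otimes> inv x) = \<zero>"
          using K(2)[OF d, of "inv x \<otimes> y \<otimes> x"] x y by (simp add: zero_eq_one)
      qed (use x dc in simp)
    qed (rule subgroup_star_annihilator[OF central])
    then have "commutator_ideal B \<subseteq> ?K"
    proof (rule commutator_ideal_subset)
      show "x \<oplus> y \<ominus> x \<ominus> y \<in> ?K" if "x \<in> carrier B" "y \<in> carrier B" for x y
        using add_commutator_in_star_annihilator[OF central that] .
      fix x y assume x: "x \<in> carrier B" and y: "y \<in> carrier B"
      let ?z = "brace_star B x y"
      have z: "?z \<in> brace_center B" using 3 star_in_center[OF central x y] by blast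
      show "?z \<in> ?K"
      proof (rule KI)
        fix w assume w: "w \<in> carrier B"
        have "w \<otimes> ?z = ?z \<otimes> w" using z w by (auto simp: brace_center_def group_center_def)
        also have "\<dots> = ?z \<oplus> w"
          using mult_eq_add_lambda[of ?z w] z w x y by (simp add: brace_center_def)
        also have "\<dots> = w \<oplus> ?z" using center_add_commute[OF star_in_center[OF central x y] w] .
        finally show "brace_star B w ?z = \<zero>"
          using w x y by (simp add: brace_star_def brace_lambda_def brace_simps)
      qed (use x y in simp)
    qed
    then show ?thesis using perfect K assms by blast
  qed
qed

text \<open>Opposite star products always lie in the star centralizer, so a small centralizer is
  useful for the opposite skew brace.\<close>

lemma star_central_opposite:
  assumes "star_centralizer B \<subseteq> group_center (add_monoid B)"
  shows "star_central (opposite B)"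
  using assms star_opposite_in_star_centralizer
  unfolding star_central_def group_center_add_opposite by auto

lemma quasi_simple_brace_trivial:
  assumes fin: "finite (carrier B)" and qs: "quasi_simple_skew_brace B"
  shows "trivial_skew_brace B \<or> almost_trivial_skew_brace B"
proof -
  interpret O: two_sided_skew_brace "opposite B" by (rule two_sided_skew_brace_opposite)
  have perfect: "carrier B \<subseteq> commutator_ideal B"
    and simple: "simple_skew_brace (B Quot brace_center B)"
    using qs by (auto simp: quasi_simple_skew_brace_def perfect_skew_brace_def)
  note cases = central_or_full_ideal[OF simple perfect]
  from cases[OF ideal_star_centralizer] show ?thesis
  proof
    assume "star_centralizer B = carrier B"
    then have "star_central B" by (simp add: star_central_iff)
    then have "trivial_skew_brace B"
      using star_trivial_if_quasi_simple[OF _ fin perfect cases] by (intro trivial_skew_braceI)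
    then show ?thesis ..
  next
    assume "star_centralizer B \<subseteq> brace_center B"
    then have "star_central (opposite B)"
      by (intro star_central_opposite) (auto simp: brace_center_def)
    moreover have "I = carrier B \<or> I \<subseteq> brace_center (opposite B)" if "brace_ideal (opposite B) I" for I
      using cases[of I] O.ideal_opposite[OF that] brace_center_opposite by auto
    ultimately have "trivial_skew_brace (opposite B)"
      using O.star_trivial_if_quasi_simple fin perfect commutator_ideal_opposite
      by (intro O.trivial_skew_braceI) auto
    then show ?thesis using trivial_opposite by simp
  qed
qed

lemma quasi_simple_add_group_trivial:
  assumes qs: "quasi_simple_group (add_monoid B)"
  shows "trivial_skew_brace B \<or> almost_trivial_skew_brace B"
proof -
  interpret O: two_sided_skew_brace "opposite B" by (rule two_sided_skew_brace_opposite)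
  have perfect: "derived (add_monoid B) (carrier B) = carrier B"
    using qs by (simp add: quasi_simple_group_def)
  have "star_centralizer B \<lhd> add_monoid B"
    using ideal_star_centralizer by (simp add: brace_ideal_def)
  then consider "star_centralizer B = carrier B" | "star_centralizer B \<subseteq> group_center (add_monoid B)"
    using quasi_simple_group_normal[OF qs] by auto
  then show ?thesis
  proof cases
    case 1
    then have "trivial_skew_brace B"
      using star_trivial_if_add_perfect[OF _ perfect] star_central_iff by (intro trivial_skew_braceI) simp
    then show ?thesis ..
  next
    case 2
    then have "trivial_skew_brace (opposite B)"
      using O.star_trivial_if_add_perfect derived_add_opposite[OF perfect] star_central_opposite
      by (intro O.trivial_skew_braceI) simp
    then show ?thesis using trivial_opposite by simp
  qed
qed

text \<open>Here a proper centralizer is only multiplicatively central, which does not make opposite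
  star products additively central. So the centralizers of \<open>B\<close> and of its opposite are
  treated together.\<close>

lemma quasi_simple_mult_group_trivial:
  assumes fin: "finite (carrier B)" and qs: "quasi_simple_group B"
  shows "trivial_skew_brace B \<or> almost_trivial_skew_brace B"
proof -
  interpret O: two_sided_skew_brace "opposite B" by (rule two_sided_skew_brace_opposite)
  let ?C = "star_centralizer B" and ?D = "star_centralizer (opposite B)"
  have perfect: "derived B (carrier B) = carrier B"
    using qs by (simp add: quasi_simple_group_def)
  have D: "brace_ideal B ?D"
    using O.ideal_opposite[OF O.ideal_star_centralizer] by simp
  note C = ideal_star_centralizer
  have "?C \<lhd> B" "?D \<lhd> B" using C D by (auto simp: brace_ideal_def)
  then consider "?C = carrier B" | "?D = carrier B" | "?C \<subseteq> group_center B" "?D \<subseteq> group_center B"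
    using quasi_simple_group_normal[OF qs] by auto
  then show ?thesis
  proof cases
    case 1
    then have "trivial_skew_brace B"
      using star_trivial_if_mult_perfect[OF _ fin perfect] star_central_iff by (intro trivial_skew_braceI) simp
    then show ?thesis ..
  next
    case 2
    then have "trivial_skew_brace (opposite B)"
      using O.star_trivial_if_mult_perfect O.star_central_iff fin derived_opposite[OF perfect]
      by (intro O.trivial_skew_braceI) simp
    then show ?thesis using trivial_opposite by simp
  next
    case 3
    let ?Z = "group_center B"
    have sub: "subgroup ?Z B"
      using group_center_normal[OF is_group] by (rule normal_imp_subgroup)
    have "a \<otimes> b \<otimes> inv a \<otimes> inv b \<in> ?Z" if a: "a \<in> carrier B" and b: "b \<in> carrier B" for a b
    proof -
      \<comment> \<open>Each kind of star product lies in the centralizer of the other kind. Hence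
        \<open>ab = k(a + b)\<close> and \<open>ba = l(a + b)\<close> with \<open>k\<close> in
        \<open>?D\<close> and \<open>l\<close> in \<open>?C\<close>, and the commutator of
        \<open>a\<close> and \<open>b\<close> is the central element
        \<open>k (inv l)\<close>.\<close>
      have "brace_star B a b \<in> ?D"
        using O.star_opposite_in_star_centralizer[of a b] a b by simp
      then obtain k where k: "k \<in> ?D" "a \<otimes> b = k \<otimes> (a \<oplus> b)"
        using ideal_mult_eq[OF D a _ b] mult_eq_star[OF a b] by metis
      obtain l where l: "l \<in> ?C" "b \<otimes> a = l \<otimes> (a \<oplus> b)"
        using ideal_mult_eq[OF C a star_opposite_in_star_centralizer[OF b a] b]
          mult_eq_star_opposite[OF b a] by metis
      have c: "k \<in> carrier B" "l \<in> carrier B"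
        using ideal_closed[OF D k(1)] ideal_closed[OF C l(1)] .
      have "a \<otimes> b \<otimes> inv a \<otimes> inv b = a \<otimes> b \<otimes> inv (b \<otimes> a)"
        using a b by (simp add: m_assoc inv_mult_group)
      also have "\<dots> = k \<otimes> inv l"
        using a b c unfolding k(2) l(2)
        by (simp add: inv_mult_group m_assoc) (simp add: m_assoc[symmetric])
      finally have eq: "a \<otimes> b \<otimes> inv a \<otimes> inv b = k \<otimes> inv l" .
      have "k \<in> ?Z" "l \<in> ?Z" using 3 k(1) l(1) by (auto dest: subsetD)
      then show ?thesis
        unfolding eq by (intro subgroup.m_closed[OF sub] subgroup.m_inv_closed[OF sub])
    qed
    \<comment> \<open>Central commutators and perfectness make the multiplicative group abelian;
      perfectness a second time makes it trivial.\<close>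
    then have Z: "?Z = carrier B"
      by (intro carrier_eq_of_derived_set_subset[OF perfect sub]) auto
    have "a \<otimes> b \<otimes> inv a \<otimes> inv b = \<one>" if "a \<in> carrier B" "b \<in> carrier B" for a b
    proof -
      have "a \<in> ?Z" using that unfolding Z by simp
      then have "a \<otimes> b = b \<otimes> a" using that(2) by (rule group_centerD)
      then have "a \<otimes> b \<otimes> inv a \<otimes> inv b = b \<otimes> a \<otimes> inv a \<otimes> inv b" by (rule arg_cong)
      also have "\<dots> = \<one>" using that by (simp add: m_assoc)
      finally show ?thesis .
    qed
    then have "{\<one>} = carrier B"
      by (intro carrier_eq_of_derived_set_subset[OF perfect triv_subgroup]) auto
    then have zero: "x = \<zero>" if "x \<in> carrier B" for x
      using that zero_eq_one by auto
    have "trivial_skew_brace B"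
      by (intro trivial_skew_braceI zero star_closed)
    then show ?thesis ..
  qed
qed

end

theorem corollary4:
  fixes B :: "('a, 'b) ring_scheme"
  assumes "two_sided_skew_brace B"
    and "finite (carrier B)"
    and "quasi_simple_skew_brace B \<or> quasi_simple_group (add_monoid B) \<or> quasi_simple_group B"
  shows "trivial_skew_brace B \<or> almost_trivial_skew_brace B"
proof -
  interpret two_sided_skew_brace B by (rule assms(1))
  show ?thesis
    using assms(3) quasi_simple_brace_trivial[OF assms(2)] quasi_simple_add_group_trivial
      quasi_simple_mult_group_trivial[OF assms(2)]
    by (elim disjE) simp_all
qed

end
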